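(* Let $\mathcal V$ be an extensive, cartesian closed category with pullbacks, $\mathcal G$ a conservative family of objects in $\mathcal V$, $\mathcal C$ a $\mathcal V$-category that admits all $\mathcal V$-tensors by objects $X\in\mathcal G$, and $F\colon\mathcal C^{\mathrm{op}}\to\mathcal V$ a $\mathcal V$-functor that preserves them. Given a pair $(C,x)$ of an object $C\in\mathcal C$ and an element $x\colon\ast\to FC$ in $\mathcal V$, the following are equivalent: (i) the $\mathcal V$-functor $F$ is $\mathcal V$-representable by $(C,x)$; (ii) the pair $(C,x)$ is a $\mathcal V$-terminal object of the underlying $\mathcal V$-category of elements $\mathrm{Und}\int_{\mathcal C}F$.
   Context: Extensive: $\mathcal V$ has all small coproducts and for every set $I$ and family $\{X_i\}_{i\in I}$ the functor $\bigsqcup_{i\in I}\colon\prod_{i\in I}\mathcal V_{/X_i}\to\mathcal V_{/\bigsqcup_i X_i}$ is an equivalence. $\ast$ is the terminal object, $[X,Y]$ the internal hom of $\mathcal V$, $\iota$ denotes coproduct inclusions. A family $\mathcal G$ of objects is conservative if a map $f\colon Y\to Z$ in $\mathcal V$ is an isomorphism if and only if $f_*\colon\mathcal V(X,Y)\to\mathcal V(X,Z)$ is a bijection for every $X\in\mathcal G$. $\mathcal V$-categories are enriched over the cartesian structure, have a set of objects, composition $c_{A,B,C}\colon\mathcal C(A,B)\times\mathcal C(B,C)\to\mathcal C(A,C)$ and identities $i_A\colon\ast\to\mathcal C(A,A)$. For $F\colon\mathcal C^{\mathrm{op}}\to\mathcal V$, $\mathrm{ev}^F_{A,B}\colon\mathcal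 C(A,B)\times FB\to FA$ is the transpose of $\mathcal C(A,B)\to[FB,FA]$. $F$ is $\mathcal V$-representable by $(C,x)$ if the $\mathcal V$-natural transformation $\alpha_x\colon\mathcal C(-,C)\Rightarrow F$ corresponding to $x$ under the enriched Yoneda lemma is an isomorphism. An object $T$ of a $\mathcal V$-category $\mathcal D$ is $\mathcal V$-terminal if $\mathcal D(A,T)\to\ast$ is an isomorphism for every $A\in\mathcal D$. $\mathcal C$ has all $\mathcal V$-tensors by $X\in\mathcal V$ if for every $C\in\mathcal C$ there are an object $C\otimes X\in\mathcal C$ and a map $\gamma\colon X\to\mathcal C(C,C\otimes X)$ such that for every $A\in\mathcal C$ the map $\mathcal C(C\otimes X,A)\to[X,\mathcal C(C,A)]$, transpose of $X\times\mathcal C(C\otimes X,A)\xrightarrow{\gamma\times\mathrm{id}}\mathcal C(C,C\otimes X)\times\mathcal C(C\otimes X,A)\xrightarrow{c}\mathcal C(C,A)$, is an isomorphism. $F$ preserves $\mathcal V$-tensors by $X$ if for every $C\in\mathcal C$ there is an isomorphism $\varphi\colon[X,FC]\cong F(C\otimes X)$ with $\mathrm{ev}^F_{C,C\otimes X}\circ(\gamma\times\varphi)=\mathrm{ev}_X\colon X\times[X,FC]\to FC$, where $\mathrm{ev}_X$ is the evaluation map. An internal category $\mathbb A$ to $\mathcal V$ consists of objects $\mathbb A_0,\mathbb A_1$ with maps $s,t\colon\mathbb A_1\to\mathbb A_0$, $i\colon\mathbb A_0\to\mathbb A_1$, $c\colon\mathbb A_1\times_{\mathbb A_0}\mathbb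 A_1\to\mathbb A_1$ satisfying the usual axioms. The underlying $\mathcal V$-category $\mathrm{Und}\,\mathbb A$ has as objects the maps $A\colon\ast\to\mathbb A_0$ in $\mathcal V$, as hom-object $\mathrm{Und}\,\mathbb A(A,B)$ the pullback of $(s,t)\colon\mathbb A_1\to\mathbb A_0\times\mathbb A_0$ along $(A,B)\colon\ast\to\mathbb A_0\times\mathbb A_0$, and composition and identities induced from $\mathbb A$. The internal category of elements $\int_{\mathcal C}F$ has $(\int_{\mathcal C}F)_0=\bigsqcup_{A}FA$, $(\int_{\mathcal C}F)_1=\bigsqcup_{A,B}\mathcal C(A,B)\times FB$; on the $(A,B)$ summand, $s$ is $\mathrm{ev}^F_{A,B}$ into $FA$ and $t$ is the projection onto $FB$; identity is induced by $i_A\times\mathrm{id}_{FA}$ and composition by $c_{A,B,C}\times\mathrm{id}_{FC}$. The pair $(C,x)$ is the object $\ast\xrightarrow{x}FC\xrightarrow{\iota_C}(\int_{\mathcal C}F)_0$ of $\mathrm{Und}\int_{\mathcal C}F$. *)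

theory Defs
  imports "HOL-Library.FuncSet" "HOL-Library.Equipollence"
begin

section \<open>Categories, functors, equivalences\<close>

record ('o, 'm) cat =
  Obj :: "'o set"
  Arr :: "'m set"
  Dom :: "'m \<Rightarrow> 'o"
  Cod :: "'m \<Rightarrow> 'o"
  Ident :: "'o \<Rightarrow> 'm"
  Comp :: "'m \<Rightarrow> 'm \<Rightarrow> 'm"  (infixr "\<cdot>\<index>" 70)

text \<open>Composition is written in applicative order: \<open>g \<cdot> f\<close> is \<open>g\<close> after \<open>f\<close>.\<close>

definition hom :: "('o, 'm) cat \<Rightarrow> 'o \<Rightarrow> 'o \<Rightarrow> 'm set" where
  "hom V X Y = {f \<in> Arr V. Dom V f = X \<and> Cod V f = Y}"

locale category =
  fixes V :: "('o, 'm) cat" (structure)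
  assumes Dom_in: "f \<in> Arr V \<Longrightarrow> Dom V f \<in> Obj V"
    and Cod_in: "f \<in> Arr V \<Longrightarrow> Cod V f \<in> Obj V"
    and Ident_in: "X \<in> Obj V \<Longrightarrow> Ident V X \<in> hom V X X"
    and Comp_in: "\<lbrakk>f \<in> hom V X Y; g \<in> hom V Y Z\<rbrakk> \<Longrightarrow> g \<cdot> f \<in> hom V X Z"
    and Comp_Ident: "f \<in> hom V X Y \<Longrightarrow> f \<cdot> Ident V X = f"
    and Ident_Comp: "f \<in> hom V X Y \<Longrightarrow> Ident V Y \<cdot> f = f"
    and Comp_assoc: "\<lbrakk>f \<in> hom V W X; g \<in> hom V X Y; h \<in> hom V Y Z\<rbrakk>
      \<Longrightarrow> h \<cdot> (g \<cdot> f) = (h \<cdot> g) \<cdot> f"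

definition iso :: "('o, 'm) cat \<Rightarrow> 'm \<Rightarrow> bool" where
  "iso V f \<longleftrightarrow> f \<in> Arr V \<and>
    (\<exists>g \<in> hom V (Cod V f) (Dom V f).
      g \<cdot>\<^bsub>V\<^esub> f = Ident V (Dom V f) \<and> f \<cdot>\<^bsub>V\<^esub> g = Ident V (Cod V f))"

record ('o, 'm, 'p, 'n) fctr =
  on_obj :: "'o \<Rightarrow> 'p"
  on_arr :: "'m \<Rightarrow> 'n"

definition is_functor ::
  "('o, 'm) cat \<Rightarrow> ('p, 'n) cat \<Rightarrow> ('o, 'm, 'p, 'n) fctr \<Rightarrow> bool" where
  "is_functor A B F \<longleftrightarrow> category A \<and> category B \<and>
    (\<forall>X \<in> Obj A. on_obj F X \<in> Obj B) \<and>
    (\<forall>f \<in> Arr A. on_arr F f \<in> hom B (on_obj F (Dom A f)) (on_obj F (Cod A f))) \<and>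
    (\<forall>X \<in> Obj A. on_arr F (Ident A X) = Ident B (on_obj F X)) \<and>
    (\<forall>f \<in> Arr A. \<forall>g \<in> Arr A. Dom A g = Cod A f \<longrightarrow>
      on_arr F (g \<cdot>\<^bsub>A\<^esub> f) = on_arr F g \<cdot>\<^bsub>B\<^esub> on_arr F f)"

definition id_fctr :: "('o, 'm, 'o, 'm) fctr" where
  "id_fctr = \<lparr>on_obj = (\<lambda>X. X), on_arr = (\<lambda>f. f)\<rparr>"

definition comp_fctr ::
  "('p, 'n, 'q, 'l) fctr \<Rightarrow> ('o, 'm, 'p, 'n) fctr \<Rightarrow> ('o, 'm, 'q, 'l) fctr" where
  "comp_fctr G F = \<lparr>on_obj = on_obj G \<circ> on_obj F, on_arr = on_arr G \<circ> on_arr F\<rparr>"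

definition nat_iso :: "('o, 'm) cat \<Rightarrow> ('p, 'n) cat \<Rightarrow>
    ('o, 'm, 'p, 'n) fctr \<Rightarrow> ('o, 'm, 'p, 'n) fctr \<Rightarrow> ('o \<Rightarrow> 'n) \<Rightarrow> bool" where
  "nat_iso A B F G \<tau> \<longleftrightarrow>
    (\<forall>X \<in> Obj A. \<tau> X \<in> hom B (on_obj F X) (on_obj G X) \<and> iso B (\<tau> X)) \<and>
    (\<forall>f \<in> Arr A. \<tau> (Cod A f) \<cdot>\<^bsub>B\<^esub> on_arr F f = on_arr G f \<cdot>\<^bsub>B\<^esub> \<tau> (Dom A f))"

definition is_equivalence ::
  "('o, 'm) cat \<Rightarrow> ('p, 'n) cat \<Rightarrow> ('o, 'm, 'p, 'n) fctr \<Rightarrow> bool" where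
  "is_equivalence A B F \<longleftrightarrow> is_functor A B F \<and>
    (\<exists>G. is_functor B A G \<and>
      (\<exists>\<eta>. nat_iso A A id_fctr (comp_fctr G F) \<eta>) \<and>
      (\<exists>\<epsilon>. nat_iso B B (comp_fctr F G) id_fctr \<epsilon>))"

text \<open>An object of the slice over \<open>X\<close> is an arrow into \<open>X\<close>; a triple \<open>(f, h, g)\<close> is the
  morphism from \<open>f\<close> to \<open>g\<close> given by \<open>h\<close> with \<open>g \<cdot> h = f\<close>.\<close>

definition slice :: "('o, 'm) cat \<Rightarrow> 'o \<Rightarrow> ('m, 'm \<times> 'm \<times> 'm) cat" where
  "slice V X = \<lparr>
    Obj = {f \<in> Arr V. Cod V f = X},
    Arr = {(f, h, g). f \<in> Arr V \<and> Cod V f = X \<and> g \<in> Arr V \<and> Cod V g = X \<and>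
      h \<in> hom V (Dom V f) (Dom V g) \<and> g \<cdot>\<^bsub>V\<^esub> h = f},
    Dom = (\<lambda>(f, h, g). f),
    Cod = (\<lambda>(f, h, g). g),
    Ident = (\<lambda>f. (f, Ident V (Dom V f), f)),
    Comp = (\<lambda>(f', k, g) (f, h, g'). (f, k \<cdot>\<^bsub>V\<^esub> h, g))\<rparr>"

definition prod_cat :: "'i set \<Rightarrow> ('i \<Rightarrow> ('o, 'm) cat) \<Rightarrow> ('i \<Rightarrow> 'o, 'i \<Rightarrow> 'm) cat" where
  "prod_cat I K = \<lparr>
    Obj = (\<Pi>\<^sub>E i\<in>I. Obj (K i)),
    Arr = (\<Pi>\<^sub>E i\<in>I. Arr (K i)),
    Dom = (\<lambda>f. \<lambda>i\<in>I. Dom (K i) (f i)),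
    Cod = (\<lambda>f. \<lambda>i\<in>I. Cod (K i) (f i)),
    Ident = (\<lambda>X. \<lambda>i\<in>I. Ident (K i) (X i)),
    Comp = (\<lambda>g f. \<lambda>i\<in>I. g i \<cdot>\<^bsub>K i\<^esub> f i)\<rparr>"


section \<open>Limits, exponentials and coproducts\<close>

text \<open>Each universal construction is a predicate, together with an arbitrary choice of a
  universal object and of the induced maps.  The chosen data are meaningful only when the
  construction exists.\<close>

definition is_terminal :: "('o, 'm) cat \<Rightarrow> 'o \<Rightarrow> bool" where
  "is_terminal V T \<longleftrightarrow> T \<in> Obj V \<and> (\<forall>X \<in> Obj V. \<exists>!f. f \<in> hom V X T)"

definition one :: "('o, 'm) cat \<Rightarrow> 'o" where
  "one V = (SOME T. is_terminal V T)"

definition bang :: "('o, 'm) cat \<Rightarrow> 'o \<Rightarrow> 'm" where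
  "bang V X = (THE f. f \<in> hom V X (one V))"

definition is_product :: "('o, 'm) cat \<Rightarrow> 'o \<Rightarrow> 'o \<Rightarrow> 'o \<Rightarrow> 'm \<Rightarrow> 'm \<Rightarrow> bool" where
  "is_product V X Y P p q \<longleftrightarrow> p \<in> hom V P X \<and> q \<in> hom V P Y \<and>
    (\<forall>Z. \<forall>f \<in> hom V Z X. \<forall>g \<in> hom V Z Y.
      \<exists>!h. h \<in> hom V Z P \<and> p \<cdot>\<^bsub>V\<^esub> h = f \<and> q \<cdot>\<^bsub>V\<^esub> h = g)"

definition prod_cone :: "('o, 'm) cat \<Rightarrow> 'o \<Rightarrow> 'o \<Rightarrow> 'o \<times> 'm \<times> 'm" where
  "prod_cone V X Y = (SOME (P, p, q). is_product V X Y P p q)"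

definition prd :: "('o, 'm) cat \<Rightarrow> 'o \<Rightarrow> 'o \<Rightarrow> 'o" where
  "prd V X Y = fst (prod_cone V X Y)"

definition prj1 :: "('o, 'm) cat \<Rightarrow> 'o \<Rightarrow> 'o \<Rightarrow> 'm" where
  "prj1 V X Y = fst (snd (prod_cone V X Y))"

definition prj2 :: "('o, 'm) cat \<Rightarrow> 'o \<Rightarrow> 'o \<Rightarrow> 'm" where
  "prj2 V X Y = snd (snd (prod_cone V X Y))"

definition tuple :: "('o, 'm) cat \<Rightarrow> 'm \<Rightarrow> 'm \<Rightarrow> 'm" where
  "tuple V f g = (THE h. h \<in> hom V (Dom V f) (prd V (Cod V f) (Cod V g)) \<and>
    prj1 V (Cod V f) (Cod V g) \<cdot>\<^bsub>V\<^esub> h = f \<and> prj2 V (Cod V f) (Cod V g) \<cdot>\<^bsub>V\<^esub> h = g)"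

definition pmap :: "('o, 'm) cat \<Rightarrow> 'm \<Rightarrow> 'm \<Rightarrow> 'm" where
  "pmap V f g = tuple V (f \<cdot>\<^bsub>V\<^esub> prj1 V (Dom V f) (Dom V g)) (g \<cdot>\<^bsub>V\<^esub> prj2 V (Dom V f) (Dom V g))"

definition swap :: "('o, 'm) cat \<Rightarrow> 'o \<Rightarrow> 'o \<Rightarrow> 'm" where
  "swap V X Y = tuple V (prj2 V X Y) (prj1 V X Y)"

text \<open>The canonical map from \<open>(X \<times> Y) \<times> Z\<close> to \<open>X \<times> (Y \<times> Z)\<close>.\<close>

definition assoc :: "('o, 'm) cat \<Rightarrow> 'o \<Rightarrow> 'o \<Rightarrow> 'o \<Rightarrow> 'm" where
  "assoc V X Y Z = tuple V
    (prj1 V X Y \<cdot>\<^bsub>V\<^esub> prj1 V (prd V X Y) Z)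
    (pmap V (prj2 V X Y) (Ident V Z))"

definition is_exponential :: "('o, 'm) cat \<Rightarrow> 'o \<Rightarrow> 'o \<Rightarrow> 'o \<Rightarrow> 'm \<Rightarrow> bool" where
  "is_exponential V X Y E e \<longleftrightarrow> E \<in> Obj V \<and> e \<in> hom V (prd V X E) Y \<and>
    (\<forall>Z \<in> Obj V. \<forall>f \<in> hom V (prd V X Z) Y.
      \<exists>!g. g \<in> hom V Z E \<and> e \<cdot>\<^bsub>V\<^esub> pmap V (Ident V X) g = f)"

definition exp_cone :: "('o, 'm) cat \<Rightarrow> 'o \<Rightarrow> 'o \<Rightarrow> 'o \<times> 'm" where
  "exp_cone V X Y = (SOME (E, e). is_exponential V X Y E e)"

definition ihom :: "('o, 'm) cat \<Rightarrow> 'o \<Rightarrow> 'o \<Rightarrow> 'o" where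
  "ihom V X Y = fst (exp_cone V X Y)"

definition evl :: "('o, 'm) cat \<Rightarrow> 'o \<Rightarrow> 'o \<Rightarrow> 'm" where
  "evl V X Y = snd (exp_cone V X Y)"

text \<open>For \<open>f\<close> from \<open>X \<times> Z\<close> to \<open>Y\<close>, its transpose from \<open>Z\<close> to \<open>[X, Y]\<close>.\<close>

definition transp :: "('o, 'm) cat \<Rightarrow> 'o \<Rightarrow> 'o \<Rightarrow> 'm \<Rightarrow> 'm" where
  "transp V X Z f = (THE g. g \<in> hom V Z (ihom V X (Cod V f)) \<and>
    evl V X (Cod V f) \<cdot>\<^bsub>V\<^esub> pmap V (Ident V X) g = f)"

definition cartesian_closed :: "('o, 'm) cat \<Rightarrow> bool" where
  "cartesian_closed V \<longleftrightarrow> category V \<and>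
    (\<exists>T. is_terminal V T) \<and>
    (\<forall>X \<in> Obj V. \<forall>Y \<in> Obj V. \<exists>P p q. is_product V X Y P p q) \<and>
    (\<forall>X \<in> Obj V. \<forall>Y \<in> Obj V. \<exists>E e. is_exponential V X Y E e)"

definition is_pullback :: "('o, 'm) cat \<Rightarrow> 'm \<Rightarrow> 'm \<Rightarrow> 'o \<Rightarrow> 'm \<Rightarrow> 'm \<Rightarrow> bool" where
  "is_pullback V f g P p q \<longleftrightarrow>
    p \<in> hom V P (Dom V f) \<and> q \<in> hom V P (Dom V g) \<and> f \<cdot>\<^bsub>V\<^esub> p = g \<cdot>\<^bsub>V\<^esub> q \<and>
    (\<forall>Z. \<forall>h \<in> hom V Z (Dom V f). \<forall>k \<in> hom V Z (Dom V g). f \<cdot>\<^bsub>V\<^esub> h = g \<cdot>\<^bsub>V\<^esub> k \<longrightarrow>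
      (\<exists>!u. u \<in> hom V Z P \<and> p \<cdot>\<^bsub>V\<^esub> u = h \<and> q \<cdot>\<^bsub>V\<^esub> u = k))"

definition has_pullbacks :: "('o, 'm) cat \<Rightarrow> bool" where
  "has_pullbacks V \<longleftrightarrow> (\<forall>f \<in> Arr V. \<forall>g \<in> Arr V. Cod V f = Cod V g \<longrightarrow>
    (\<exists>P p q. is_pullback V f g P p q))"

definition pb_cone :: "('o, 'm) cat \<Rightarrow> 'm \<Rightarrow> 'm \<Rightarrow> 'o \<times> 'm \<times> 'm" where
  "pb_cone V f g = (SOME (P, p, q). is_pullback V f g P p q)"

definition pb :: "('o, 'm) cat \<Rightarrow> 'm \<Rightarrow> 'm \<Rightarrow> 'o" where
  "pb V f g = fst (pb_cone V f g)"

definition pb1 :: "('o, 'm) cat \<Rightarrow> 'm \<Rightarrow> 'm \<Rightarrow> 'm" where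
  "pb1 V f g = fst (snd (pb_cone V f g))"

definition pb2 :: "('o, 'm) cat \<Rightarrow> 'm \<Rightarrow> 'm \<Rightarrow> 'm" where
  "pb2 V f g = snd (snd (pb_cone V f g))"

definition pb_tuple :: "('o, 'm) cat \<Rightarrow> 'm \<Rightarrow> 'm \<Rightarrow> 'm \<Rightarrow> 'm \<Rightarrow> 'm" where
  "pb_tuple V f g h k = (THE u. u \<in> hom V (Dom V h) (pb V f g) \<and>
    pb1 V f g \<cdot>\<^bsub>V\<^esub> u = h \<and> pb2 V f g \<cdot>\<^bsub>V\<^esub> u = k)"

definition is_coproduct ::
  "('o, 'm) cat \<Rightarrow> 'i set \<Rightarrow> ('i \<Rightarrow> 'o) \<Rightarrow> 'o \<Rightarrow> ('i \<Rightarrow> 'm) \<Rightarrow> bool" where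
  "is_coproduct V I X S \<iota> \<longleftrightarrow> S \<in> Obj V \<and> (\<forall>i \<in> I. \<iota> i \<in> hom V (X i) S) \<and>
    (\<forall>Z \<in> Obj V. \<forall>f. (\<forall>i \<in> I. f i \<in> hom V (X i) Z) \<longrightarrow>
      (\<exists>!h. h \<in> hom V S Z \<and> (\<forall>i \<in> I. h \<cdot>\<^bsub>V\<^esub> \<iota> i = f i)))"

definition coprod_cocone :: "('o, 'm) cat \<Rightarrow> 'i set \<Rightarrow> ('i \<Rightarrow> 'o) \<Rightarrow> 'o \<times> ('i \<Rightarrow> 'm)" where
  "coprod_cocone V I X = (SOME (S, \<iota>). is_coproduct V I X S \<iota>)"

definition coprod :: "('o, 'm) cat \<Rightarrow> 'i set \<Rightarrow> ('i \<Rightarrow> 'o) \<Rightarrow> 'o" where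
  "coprod V I X = fst (coprod_cocone V I X)"

definition incl :: "('o, 'm) cat \<Rightarrow> 'i set \<Rightarrow> ('i \<Rightarrow> 'o) \<Rightarrow> 'i \<Rightarrow> 'm" where
  "incl V I X = snd (coprod_cocone V I X)"

definition cotuple :: "('o, 'm) cat \<Rightarrow> 'i set \<Rightarrow> ('i \<Rightarrow> 'o) \<Rightarrow> 'o \<Rightarrow> ('i \<Rightarrow> 'm) \<Rightarrow> 'm" where
  "cotuple V I X Z f = (THE h. h \<in> hom V (coprod V I X) Z \<and>
    (\<forall>i \<in> I. h \<cdot>\<^bsub>V\<^esub> incl V I X i = f i))"

definition coprod_map ::
  "('o, 'm) cat \<Rightarrow> 'i set \<Rightarrow> ('i \<Rightarrow> 'o) \<Rightarrow> ('i \<Rightarrow> 'o) \<Rightarrow> ('i \<Rightarrow> 'm) \<Rightarrow> 'm" where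
  "coprod_map V I X Y f = cotuple V I X (coprod V I Y) (\<lambda>i. incl V I Y i \<cdot>\<^bsub>V\<^esub> f i)"

definition slice_coprod :: "('o, 'm) cat \<Rightarrow> 'i set \<Rightarrow> ('i \<Rightarrow> 'o) \<Rightarrow>
    ('i \<Rightarrow> 'm, 'i \<Rightarrow> 'm \<times> 'm \<times> 'm, 'm, 'm \<times> 'm \<times> 'm) fctr" where
  "slice_coprod V I X =
    (let sum_obj = (\<lambda>f. coprod_map V I (\<lambda>i. Dom V (f i)) X f) in \<lparr>
      on_obj = sum_obj,
      on_arr = (\<lambda>m.
        let f = (\<lambda>i. fst (m i)); h = (\<lambda>i. fst (snd (m i))); g = (\<lambda>i. snd (snd (m i)))
        in (sum_obj f,
            coprod_map V I (\<lambda>i. Dom V (f i)) (\<lambda>i. Dom V (g i)) h,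
            sum_obj g))\<rparr>)"

text \<open>The set \<open>U\<close> bounds the size of small sets: coproducts are indexed by the subsets of
  \<open>U\<close>, and a set of another type is small if it embeds into \<open>U\<close>.  For infinite \<open>U\<close>, small
  sets are closed under finite products.\<close>

definition extensive :: "'u set \<Rightarrow> ('o, 'm) cat \<Rightarrow> bool" where
  "extensive U V \<longleftrightarrow> (\<forall>I X. I \<subseteq> U \<longrightarrow> (\<forall>i \<in> I. X i \<in> Obj V) \<longrightarrow>
    (\<exists>S \<iota>. is_coproduct V I X S \<iota>) \<and>
    is_equivalence (prod_cat I (\<lambda>i. slice V (X i))) (slice V (coprod V I X))
      (slice_coprod V I X))"

definition conservative :: "('o, 'm) cat \<Rightarrow> 'o set \<Rightarrow> bool" where
  "conservative V G \<longleftrightarrow> G \<subseteq> Obj V \<and>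
    (\<forall>Y Z. \<forall>f \<in> hom V Y Z.
      iso V f \<longleftrightarrow> (\<forall>X \<in> G. bij_betw (\<lambda>h. f \<cdot>\<^bsub>V\<^esub> h) (hom V X Y) (hom V X Z)))"


section \<open>Enriched categories\<close>

record ('c, 'o, 'm) vcat =
  VObj :: "'c set"
  VHom :: "'c \<Rightarrow> 'c \<Rightarrow> 'o"
  VComp :: "'c \<Rightarrow> 'c \<Rightarrow> 'c \<Rightarrow> 'm"
  VId :: "'c \<Rightarrow> 'm"

text \<open>\<open>VComp C a b d\<close> goes from \<open>C(a, b) \<times> C(b, d)\<close> to \<open>C(a, d)\<close>.\<close>

definition vcategory :: "('o, 'm) cat \<Rightarrow> ('c, 'o, 'm) vcat \<Rightarrow> bool" where
  "vcategory V C \<longleftrightarrow>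
    (\<forall>a \<in> VObj C. \<forall>b \<in> VObj C. VHom C a b \<in> Obj V) \<and>
    (\<forall>a \<in> VObj C. \<forall>b \<in> VObj C. \<forall>d \<in> VObj C.
      VComp C a b d \<in> hom V (prd V (VHom C a b) (VHom C b d)) (VHom C a d)) \<and>
    (\<forall>a \<in> VObj C. VId C a \<in> hom V (one V) (VHom C a a)) \<and>
    (\<forall>a \<in> VObj C. \<forall>b \<in> VObj C. \<forall>d \<in> VObj C. \<forall>e \<in> VObj C.
      VComp C a d e \<cdot>\<^bsub>V\<^esub> pmap V (VComp C a b d) (Ident V (VHom C d e)) =
      VComp C a b e \<cdot>\<^bsub>V\<^esub> pmap V (Ident V (VHom C a b)) (VComp C b d e)
        \<cdot>\<^bsub>V\<^esub> assoc V (VHom C a b) (VHom C b d) (VHom C d e)) \<and>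
    (\<forall>a \<in> VObj C. \<forall>b \<in> VObj C.
      VComp C a a b \<cdot>\<^bsub>V\<^esub> pmap V (VId C a) (Ident V (VHom C a b)) =
      prj2 V (one V) (VHom C a b)) \<and>
    (\<forall>a \<in> VObj C. \<forall>b \<in> VObj C.
      VComp C a b b \<cdot>\<^bsub>V\<^esub> pmap V (Ident V (VHom C a b)) (VId C b) =
      prj1 V (VHom C a b) (one V))"

definition vop :: "('o, 'm) cat \<Rightarrow> ('c, 'o, 'm) vcat \<Rightarrow> ('c, 'o, 'm) vcat" where
  "vop V C = \<lparr>
    VObj = VObj C,
    VHom = (\<lambda>a b. VHom C b a),
    VComp = (\<lambda>a b d. VComp C d b a \<cdot>\<^bsub>V\<^esub> swap V (VHom C b a) (VHom C d b)),
    VId = VId C\<rparr>"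

text \<open>The cartesian closed category \<open>V\<close> as a category enriched over itself.  Composition is the
  transpose of the double evaluation from \<open>X \<times> ([X, Y] \<times> [Y, Z])\<close> to \<open>Z\<close>.\<close>

definition vself :: "('o, 'm) cat \<Rightarrow> ('o, 'o, 'm) vcat" where
  "vself V = \<lparr>
    VObj = Obj V,
    VHom = ihom V,
    VComp = (\<lambda>X Y Z.
      let H = ihom V X Y; K = ihom V Y Z in
      transp V X (prd V H K)
        (evl V Y Z \<cdot>\<^bsub>V\<^esub> tuple V
          (evl V X Y \<cdot>\<^bsub>V\<^esub> pmap V (Ident V X) (prj1 V H K))
          (prj2 V H K \<cdot>\<^bsub>V\<^esub> prj2 V X (prd V H K)))),
    VId = (\<lambda>X. transp V X (one V) (prj1 V X (one V)))\<rparr>"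

record ('c, 'd, 'm) vfun =
  FObj :: "'c \<Rightarrow> 'd"
  FMap :: "'c \<Rightarrow> 'c \<Rightarrow> 'm"

definition vfunctor :: "('o, 'm) cat \<Rightarrow> ('c, 'o, 'm) vcat \<Rightarrow> ('d, 'o, 'm) vcat \<Rightarrow>
    ('c, 'd, 'm) vfun \<Rightarrow> bool" where
  "vfunctor V C D F \<longleftrightarrow>
    (\<forall>a \<in> VObj C. FObj F a \<in> VObj D) \<and>
    (\<forall>a \<in> VObj C. \<forall>b \<in> VObj C.
      FMap F a b \<in> hom V (VHom C a b) (VHom D (FObj F a) (FObj F b))) \<and>
    (\<forall>a \<in> VObj C. FMap F a a \<cdot>\<^bsub>V\<^esub> VId C a = VId D (FObj F a)) \<and>
    (\<forall>a \<in> VObj C. \<forall>b \<in> VObj C. \<forall>d \<in> VObj C.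
      FMap F a d \<cdot>\<^bsub>V\<^esub> VComp C a b d =
      VComp D (FObj F a) (FObj F b) (FObj F d) \<cdot>\<^bsub>V\<^esub> pmap V (FMap F a b) (FMap F b d))"

text \<open>A presheaf on \<open>C\<close> is a functor \<open>F\<close> from \<open>vop V C\<close> to \<open>vself V\<close>, so that \<open>FMap F b a\<close>
  goes from \<open>C(a, b)\<close> to \<open>[F b, F a]\<close>; its transpose \<open>ev_psh V C F a b\<close> goes from
  \<open>C(a, b) \<times> F b\<close> to \<open>F a\<close>.\<close>

definition ev_psh ::
  "('o, 'm) cat \<Rightarrow> ('c, 'o, 'm) vcat \<Rightarrow> ('c, 'o, 'm) vfun \<Rightarrow> 'c \<Rightarrow> 'c \<Rightarrow> 'm" where
  "ev_psh V C F a b =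
    evl V (FObj F b) (FObj F a) \<cdot>\<^bsub>V\<^esub> pmap V (Ident V (FObj F b)) (FMap F b a)
      \<cdot>\<^bsub>V\<^esub> swap V (VHom C a b) (FObj F b)"

definition rep_psh ::
  "('o, 'm) cat \<Rightarrow> ('c, 'o, 'm) vcat \<Rightarrow> 'c \<Rightarrow> ('c, 'o, 'm) vfun" where
  "rep_psh V C c = \<lparr>
    FObj = (\<lambda>a. VHom C a c),
    FMap = (\<lambda>b a. transp V (VHom C b c) (VHom C a b)
      (VComp C a b c \<cdot>\<^bsub>V\<^esub> swap V (VHom C b c) (VHom C a b)))\<rparr>"

text \<open>Naturality of a transformation between presheaves, with components \<open>F a \<rightarrow> G a\<close>, stated
  after transposition along \<open>C(a, b) \<times> -\<close>.\<close>

definition vnat_psh :: "('o, 'm) cat \<Rightarrow> ('c, 'o, 'm) vcat \<Rightarrow>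
    ('c, 'o, 'm) vfun \<Rightarrow> ('c, 'o, 'm) vfun \<Rightarrow> ('c \<Rightarrow> 'm) \<Rightarrow> bool" where
  "vnat_psh V C F G \<alpha> \<longleftrightarrow>
    (\<forall>a \<in> VObj C. \<alpha> a \<in> hom V (FObj F a) (FObj G a)) \<and>
    (\<forall>a \<in> VObj C. \<forall>b \<in> VObj C.
      \<alpha> a \<cdot>\<^bsub>V\<^esub> ev_psh V C F a b =
      ev_psh V C G a b \<cdot>\<^bsub>V\<^esub> pmap V (Ident V (VHom C a b)) (\<alpha> b))"

text \<open>Under the enriched Yoneda lemma, a transformation \<open>\<alpha>\<close> from \<open>C(-, c)\<close> to \<open>F\<close> corresponds
  to the element \<open>\<alpha> c \<cdot> VId C c\<close> of \<open>F c\<close>.\<close>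

definition representable_by :: "('o, 'm) cat \<Rightarrow> ('c, 'o, 'm) vcat \<Rightarrow>
    ('c, 'o, 'm) vfun \<Rightarrow> 'c \<Rightarrow> 'm \<Rightarrow> bool" where
  "representable_by V C F c x \<longleftrightarrow>
    (\<exists>\<alpha>. vnat_psh V C (rep_psh V C c) F \<alpha> \<and> \<alpha> c \<cdot>\<^bsub>V\<^esub> VId C c = x \<and>
      (\<forall>a \<in> VObj C. iso V (\<alpha> a)))"

definition vterminal :: "('o, 'm) cat \<Rightarrow> ('c, 'o, 'm) vcat \<Rightarrow> 'c \<Rightarrow> bool" where
  "vterminal V D T \<longleftrightarrow> T \<in> VObj D \<and> (\<forall>a \<in> VObj D. iso V (bang V (VHom D a T)))"

definition is_tensor :: "('o, 'm) cat \<Rightarrow> ('c, 'o, 'm) vcat \<Rightarrow> 'o \<Rightarrow> 'c \<Rightarrow> 'c \<Rightarrow> 'm \<Rightarrow> bool" where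
  "is_tensor V C X c t \<gamma> \<longleftrightarrow> t \<in> VObj C \<and> \<gamma> \<in> hom V X (VHom C c t) \<and>
    (\<forall>a \<in> VObj C. iso V (transp V X (VHom C t a)
      (VComp C c t a \<cdot>\<^bsub>V\<^esub> pmap V \<gamma> (Ident V (VHom C t a)))))"

definition has_tensors :: "('o, 'm) cat \<Rightarrow> ('c, 'o, 'm) vcat \<Rightarrow> 'o \<Rightarrow> bool" where
  "has_tensors V C X \<longleftrightarrow> (\<forall>c \<in> VObj C. \<exists>t \<gamma>. is_tensor V C X c t \<gamma>)"

definition preserves_tensors ::
  "('o, 'm) cat \<Rightarrow> ('c, 'o, 'm) vcat \<Rightarrow> ('c, 'o, 'm) vfun \<Rightarrow> 'o \<Rightarrow> bool" where
  "preserves_tensors V C F X \<longleftrightarrow> (\<forall>c \<in> VObj C. \<forall>t \<gamma>. is_tensor V C X c t \<gamma> \<longrightarrow>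
    (\<exists>\<phi> \<in> hom V (ihom V X (FObj F c)) (FObj F t). iso V \<phi> \<and>
      ev_psh V C F c t \<cdot>\<^bsub>V\<^esub> pmap V \<gamma> \<phi> = evl V X (FObj F c)))"


section \<open>Internal categories\<close>

record ('o, 'm) icat =
  I0 :: "'o"
  I1 :: "'o"
  src :: "'m"
  tgt :: "'m"
  idt :: "'m"
  cmp :: "'m"

text \<open>The composition \<open>cmp\<close> is defined on the pullback of \<open>tgt\<close> and \<open>src\<close>, whose first
  component is the arrow applied first.\<close>

definition internal_category :: "('o, 'm) cat \<Rightarrow> ('o, 'm) icat \<Rightarrow> bool" where
  "internal_category V A \<longleftrightarrow>
    (let s = src A; t = tgt A; i = idt A; c = cmp A;
         p = pb1 V t s; q = pb2 V t s; P = pb V t s;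
         l = pb1 V q p; r = pb2 V q p
     in I0 A \<in> Obj V \<and> I1 A \<in> Obj V \<and>
      s \<in> hom V (I1 A) (I0 A) \<and> t \<in> hom V (I1 A) (I0 A) \<and>
      i \<in> hom V (I0 A) (I1 A) \<and> c \<in> hom V P (I1 A) \<and>
      s \<cdot>\<^bsub>V\<^esub> i = Ident V (I0 A) \<and> t \<cdot>\<^bsub>V\<^esub> i = Ident V (I0 A) \<and>
      s \<cdot>\<^bsub>V\<^esub> c = s \<cdot>\<^bsub>V\<^esub> p \<and> t \<cdot>\<^bsub>V\<^esub> c = t \<cdot>\<^bsub>V\<^esub> q \<and>
      c \<cdot>\<^bsub>V\<^esub> pb_tuple V t s (i \<cdot>\<^bsub>V\<^esub> s) (Ident V (I1 A)) = Ident V (I1 A) \<and>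
      c \<cdot>\<^bsub>V\<^esub> pb_tuple V t s (Ident V (I1 A)) (i \<cdot>\<^bsub>V\<^esub> t) = Ident V (I1 A) \<and>
      c \<cdot>\<^bsub>V\<^esub> pb_tuple V t s (c \<cdot>\<^bsub>V\<^esub> l) (q \<cdot>\<^bsub>V\<^esub> r) =
      c \<cdot>\<^bsub>V\<^esub> pb_tuple V t s (p \<cdot>\<^bsub>V\<^esub> l) (c \<cdot>\<^bsub>V\<^esub> r))"

definition und :: "('o, 'm) cat \<Rightarrow> ('o, 'm) icat \<Rightarrow> ('m, 'o, 'm) vcat" where
  "und V A =
    (let st = tuple V (src A) (tgt A);
         H = (\<lambda>a b. pb V st (tuple V a b));
         arr = (\<lambda>a b. pb1 V st (tuple V a b));
         ind = (\<lambda>a b Z f. pb_tuple V st (tuple V a b) f (bang V Z))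
     in \<lparr>
      VObj = hom V (one V) (I0 A),
      VHom = H,
      VComp = (\<lambda>a b d. ind a d (prd V (H a b) (H b d))
        (cmp A \<cdot>\<^bsub>V\<^esub> pb_tuple V (tgt A) (src A)
          (arr a b \<cdot>\<^bsub>V\<^esub> prj1 V (H a b) (H b d))
          (arr b d \<cdot>\<^bsub>V\<^esub> prj2 V (H a b) (H b d)))),
      VId = (\<lambda>a. ind a a (one V) (idt A \<cdot>\<^bsub>V\<^esub> a))\<rparr>)"

text \<open>By extensivity, the pullback of \<open>tgt\<close> and \<open>src\<close> in the category of elements is the
  coproduct of the objects \<open>(C(a, b) \<times> C(b, d)) \<times> F d\<close> along the maps \<open>j a b d\<close> below, so that
  the composition is the unique map with the prescribed restrictions along them.\<close>

definition elements ::
  "('o, 'm) cat \<Rightarrow> ('c, 'o, 'm) vcat \<Rightarrow> ('c, 'o, 'm) vfun \<Rightarrow> ('o, 'm) icat" where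
  "elements V C F =
    (let J = VObj C;
         Q = (\<lambda>(a, b). prd V (VHom C a b) (FObj F b));
         E0 = coprod V J (FObj F);
         E1 = coprod V (J \<times> J) Q;
         \<iota>0 = incl V J (FObj F);
         \<iota>1 = incl V (J \<times> J) Q;
         s = cotuple V (J \<times> J) Q E0 (\<lambda>(a, b). \<iota>0 a \<cdot>\<^bsub>V\<^esub> ev_psh V C F a b);
         t = cotuple V (J \<times> J) Q E0 (\<lambda>(a, b). \<iota>0 b \<cdot>\<^bsub>V\<^esub> prj2 V (VHom C a b) (FObj F b));
         j = (\<lambda>a b d. pb_tuple V t s
           (\<iota>1 (a, b) \<cdot>\<^bsub>V\<^esub> pmap V (Ident V (VHom C a b)) (ev_psh V C F b d)
             \<cdot>\<^bsub>V\<^esub> assoc V (VHom C a b) (VHom C b d) (FObj F d))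
           (\<iota>1 (b, d) \<cdot>\<^bsub>V\<^esub> pmap V (prj2 V (VHom C a b) (VHom C b d)) (Ident V (FObj F d))))
     in \<lparr>
      I0 = E0,
      I1 = E1,
      src = s,
      tgt = t,
      idt = cotuple V J (FObj F) E1 (\<lambda>a. \<iota>1 (a, a)
        \<cdot>\<^bsub>V\<^esub> tuple V (VId C a \<cdot>\<^bsub>V\<^esub> bang V (FObj F a)) (Ident V (FObj F a))),
      cmp = (THE m. m \<in> hom V (pb V t s) E1 \<and>
        (\<forall>a \<in> J. \<forall>b \<in> J. \<forall>d \<in> J.
          m \<cdot>\<^bsub>V\<^esub> j a b d = \<iota>1 (a, d) \<cdot>\<^bsub>V\<^esub> pmap V (VComp C a b d) (Ident V (FObj F d))))\<rparr>)"

definition element ::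
  "('o, 'm) cat \<Rightarrow> ('c, 'o, 'm) vcat \<Rightarrow> ('c, 'o, 'm) vfun \<Rightarrow> 'c \<Rightarrow> 'm \<Rightarrow> 'm" where
  "element V C F c x = incl V (VObj C) (FObj F) c \<cdot>\<^bsub>V\<^esub> x"

end

theory Submission
  imports Defs
begin

text \<open>
  For an object \<open>a\<close> of \<open>C\<close> write \<open>\<alpha>\<^sub>a\<close> for the map from \<open>C(a, c)\<close> to \<open>F a\<close> that restricts
  \<open>x\<close> along an arrow; in the theory it is \<open>yoneda a\<close>.  By the Yoneda lemma, \<open>F\<close> is
  represented by \<open>(c, x)\<close> iff every \<open>\<alpha>\<^sub>a\<close> is an isomorphism (\<open>representable_iff\<close>).

  Let \<open>E0\<close> and \<open>E1\<close> be the objects of objects and of arrows of the category of elements.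
  An arrow from \<open>g\<close> to \<open>(c, x)\<close> at stage \<open>Z\<close> is a map from \<open>Z\<close> to \<open>E1\<close> whose source and
  target are the constant maps at \<open>g\<close> and \<open>(c, x)\<close>, and \<open>(c, x)\<close> is terminal iff there is
  exactly one for every global element \<open>g\<close> of \<open>E0\<close> and every \<open>Z\<close> (\<open>vterminal_iff\<close>).
  The link between the two sides is \<open>arrow_over\<close>: if the source and the target of a map
  \<open>Z \<rightarrow> E1\<close> factor through the summands \<open>F a\<close> and \<open>F b\<close> of \<open>E0\<close>, then the map factors
  through the summand \<open>C(a, b) \<times> F b\<close> of \<open>E1\<close>.  Indeed, by extensivity \<open>Z\<close> is a
  coproduct of pieces each of which is sent into one summand of \<open>E1\<close>, and as coproducts are
  disjoint, all pieces but the one at \<open>(a, b)\<close> are initial.  Hence the arrows at stage \<open>Z\<close>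
  from an element \<open>z\<close> of \<open>F a\<close> to \<open>(c, x)\<close> are the lifts of \<open>z\<close> along \<open>\<alpha>\<^sub>a\<close>.

  Suppose that every \<open>\<alpha>\<^sub>a\<close> is an isomorphism.  A global element \<open>g\<close> of \<open>E0\<close> need not
  factor through a summand, since the terminal object may be disconnected.  But \<open>Z\<close> splits
  into pieces on which the constant map at \<open>g\<close> does, the lifts on these pieces exist and are
  unique, and they glue to the unique arrow from \<open>g\<close> to \<open>(c, x)\<close>.

  Suppose that \<open>(c, x)\<close> is terminal.  With \<open>g\<close> in the summand \<open>F a\<close> and \<open>Z\<close> terminal,
  the link shows that \<open>\<alpha>\<^sub>a\<close> is bijective on global elements, for every \<open>a\<close>.  Tensors turn
  this into a statement about maps out of \<open>X \<in> G\<close>: maps from \<open>X\<close> to \<open>C(a, c)\<close> are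
  global elements of \<open>C(a \<otimes> X, c)\<close>, maps from \<open>X\<close> to \<open>F a\<close> are global elements of
  \<open>F (a \<otimes> X)\<close>, and these correspondences carry \<open>\<alpha>\<^sub>a\<close> to \<open>\<alpha>\<close> at \<open>a \<otimes> X\<close>
  (\<open>yoneda_bij_on_tensor_elements\<close>).  As \<open>G\<close> is conservative, \<open>\<alpha>\<^sub>a\<close> is an isomorphism.
\<close>


section \<open>Categories and isomorphisms\<close>

text \<open>The rules below type composites through \<^const>\<open>Dom\<close> and \<^const>\<open>Cod\<close> rather than through
  \<^const>\<open>hom\<close>, so that their premises contain no variables the simplifier would have to guess.
  Facts about \<^const>\<open>hom\<close> are therefore unfolded before simplification.\<close>

context category
begin

lemma Arr_Comp [simp]: "\<lbrakk>f \<in> Arr V; g \<in> Arr V; Dom V g = Cod V f\<rbrakk> \<Longrightarrow> g \<cdot> f \<in> Arr V"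
  and Dom_Comp [simp]: "\<lbrakk>f \<in> Arr V; g \<in> Arr V; Dom V g = Cod V f\<rbrakk> \<Longrightarrow> Dom V (g \<cdot> f) = Dom V f"
  and Cod_Comp [simp]: "\<lbrakk>f \<in> Arr V; g \<in> Arr V; Dom V g = Cod V f\<rbrakk> \<Longrightarrow> Cod V (g \<cdot> f) = Cod V g"
  using Comp_in[of f "Dom V f" "Cod V f" g "Cod V g"] by (simp_all add: hom_def)

lemma Arr_Ident [simp]: "X \<in> Obj V \<Longrightarrow> Ident V X \<in> Arr V"
  and Dom_Ident [simp]: "X \<in> Obj V \<Longrightarrow> Dom V (Ident V X) = X"
  and Cod_Ident [simp]: "X \<in> Obj V \<Longrightarrow> Cod V (Ident V X) = X"
  using Ident_in[of X] by (simp_all add: hom_def)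

lemma Comp_Ident' [simp]: "\<lbrakk>f \<in> Arr V; Dom V f = X\<rbrakk> \<Longrightarrow> f \<cdot> Ident V X = f"
  and Ident_Comp' [simp]: "\<lbrakk>f \<in> Arr V; Cod V f = X\<rbrakk> \<Longrightarrow> Ident V X \<cdot> f = f"
  using Comp_Ident[of f X "Cod V f"] Ident_Comp[of f "Dom V f" X] by (simp_all add: hom_def)

lemma Comp_assoc' [simp]:
  "\<lbrakk>f \<in> Arr V; g \<in> Arr V; h \<in> Arr V; Dom V g = Cod V f; Dom V h = Cod V g\<rbrakk>
    \<Longrightarrow> (h \<cdot> g) \<cdot> f = h \<cdot> (g \<cdot> f)"
  using Comp_assoc[of f "Dom V f" "Cod V f" g "Cod V g" h "Cod V h"] by (simp add: hom_def)

lemma hom_Obj: "f \<in> hom V X Y \<Longrightarrow> X \<in> Obj V \<and> Y \<in> Obj V"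
  using Dom_in Cod_in by (auto simp: hom_def)

lemma isoI:
  assumes "f \<in> hom V X Y" "g \<in> hom V Y X" "g \<cdot> f = Ident V X" "f \<cdot> g = Ident V Y"
  shows "iso V f"
  using assms by (auto simp: iso_def hom_def)

lemma isoE:
  assumes "iso V f" "f \<in> hom V X Y"
  obtains g where "g \<in> hom V Y X" "g \<cdot> f = Ident V X" "f \<cdot> g = Ident V Y"
  using assms by (auto simp: iso_def hom_def)

lemma iso_right_cancel:
  assumes "iso V e" "e \<in> hom V X Y" "u \<in> hom V Y Z" "v \<in> hom V Y Z" "u \<cdot> e = v \<cdot> e"
  shows "u = v"
proof -
  obtain e' where e': "e' \<in> hom V Y X" "e \<cdot> e' = Ident V Y"
    using isoE[OF assms(1,2)] by blast
  have "u = (u \<cdot> e) \<cdot> e'"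
    using assms(1-4) e' hom_Obj[OF assms(2)] by (simp add: hom_def)
  also have "\<dots> = (v \<cdot> e) \<cdot> e'"
    by (simp only: assms(5))
  also have "\<dots> = v"
    using assms(1-4) e' hom_Obj[OF assms(2)] by (simp add: hom_def)
  finally show ?thesis .
qed

lemma iso_left_cancel:
  assumes "iso V e" "e \<in> hom V X Y" "u \<in> hom V Z X" "v \<in> hom V Z X" "e \<cdot> u = e \<cdot> v"
  shows "u = v"
proof -
  obtain e' where e': "e' \<in> hom V Y X" "e' \<cdot> e = Ident V X"
    using isoE[OF assms(1,2)] by blast
  have "u = (e' \<cdot> e) \<cdot> u"
    using assms(2-4) e' by (simp add: hom_def)
  also have "\<dots> = e' \<cdot> (e \<cdot> u)"
    using assms(2-4) e'(1) by (simp add: hom_def)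
  also have "\<dots> = (e' \<cdot> e) \<cdot> v"
    using assms(2-4) e'(1) by (simp add: hom_def assms(5))
  also have "\<dots> = v"
    using assms(2-4) e' by (simp add: hom_def)
  finally show ?thesis .
qed

end


section \<open>Equivalences are full and essentially surjective\<close>

text \<open>Let \<open>G\<close> be a quasi-inverse of \<open>F\<close>.  The preimage of \<open>m\<close> is the composite of \<open>G m\<close> with the
  unit at \<open>f\<close> and the inverse of the unit at \<open>g\<close>.  Its image under \<open>F\<close> agrees with \<open>m\<close> after applying \<open>G\<close>, and \<open>G\<close> is faithful
  because of the counit.\<close>

lemma equivalence_full:
  assumes eq: "is_equivalence A B F"
    and f: "f \<in> Obj A" and g: "g \<in> Obj A"
    and m: "m \<in> hom B (on_obj F f) (on_obj F g)"
  obtains u where "u \<in> hom A f g" "on_arr F u = m"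
proof -
  obtain G \<eta> \<epsilon> where F: "is_functor A B F" and G: "is_functor B A G"
    and \<eta>: "nat_iso A A id_fctr (comp_fctr G F) \<eta>"
    and \<epsilon>: "nat_iso B B (comp_fctr F G) id_fctr \<epsilon>"
    using eq by (auto simp: is_equivalence_def)
  interpret A: category A using F by (simp add: is_functor_def)
  interpret B: category B using F by (simp add: is_functor_def)
  have Farr: "on_arr F u \<in> hom B (on_obj F p) (on_obj F q)" if "u \<in> hom A p q" for u p q
    using F that by (auto simp: is_functor_def hom_def)
  have Garr: "on_arr G u \<in> hom A (on_obj G p) (on_obj G q)" if "u \<in> hom B p q" for u p q
    using G that by (auto simp: is_functor_def hom_def)
  have \<eta>': "\<eta> p \<in> hom A p (on_obj G (on_obj F p))" "iso A (\<eta> p)" if "p \<in> Obj A" for p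
    using \<eta> that by (auto simp: nat_iso_def id_fctr_def comp_fctr_def)
  have \<eta>_nat: "\<eta> q \<cdot>\<^bsub>A\<^esub> u = on_arr G (on_arr F u) \<cdot>\<^bsub>A\<^esub> \<eta> p" if "u \<in> hom A p q" for u p q
    using \<eta> that by (auto simp: nat_iso_def id_fctr_def comp_fctr_def hom_def)
  have \<epsilon>': "\<epsilon> p \<in> hom B (on_obj F (on_obj G p)) p" "iso B (\<epsilon> p)" if "p \<in> Obj B" for p
    using \<epsilon> that by (auto simp: nat_iso_def id_fctr_def comp_fctr_def)
  have \<epsilon>_nat: "\<epsilon> q \<cdot>\<^bsub>B\<^esub> on_arr F (on_arr G u) = u \<cdot>\<^bsub>B\<^esub> \<epsilon> p" if "u \<in> hom B p q" for u p q
    using \<epsilon> that by (auto simp: nat_iso_def id_fctr_def comp_fctr_def hom_def)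
  have faithful: "u = v"
    if "u \<in> hom B p q" "v \<in> hom B p q" "on_arr G u = on_arr G v" for u v p q
  proof -
    have "u \<cdot>\<^bsub>B\<^esub> \<epsilon> p = v \<cdot>\<^bsub>B\<^esub> \<epsilon> p"
      using \<epsilon>_nat[OF that(1)] \<epsilon>_nat[OF that(2)] that(3) by simp
    then show ?thesis
      using B.iso_right_cancel[OF \<epsilon>'(2,1) that(1,2)] B.hom_Obj[OF that(1)] by blast
  qed
  obtain k where k: "k \<in> hom A (on_obj G (on_obj F g)) g"
      "\<eta> g \<cdot>\<^bsub>A\<^esub> k = Ident A (on_obj G (on_obj F g))"
    using A.isoE[OF \<eta>'(2,1)[OF g]] by blast
  define u where "u = k \<cdot>\<^bsub>A\<^esub> (on_arr G m \<cdot>\<^bsub>A\<^esub> \<eta> f)"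
  have u: "u \<in> hom A f g"
    unfolding u_def using A.Comp_in[OF A.Comp_in[OF \<eta>'(1)[OF f] Garr[OF m]] k(1)] .
  have "on_arr G (on_arr F u) \<cdot>\<^bsub>A\<^esub> \<eta> f = \<eta> g \<cdot>\<^bsub>A\<^esub> u"
    using \<eta>_nat[OF u] by simp
  also have "\<dots> = (\<eta> g \<cdot>\<^bsub>A\<^esub> k) \<cdot>\<^bsub>A\<^esub> (on_arr G m \<cdot>\<^bsub>A\<^esub> \<eta> f)"
    using k(1) \<eta>'(1)[OF f] \<eta>'(1)[OF g] Garr[OF m] by (simp add: hom_def u_def)
  also have "\<dots> = on_arr G m \<cdot>\<^bsub>A\<^esub> \<eta> f"
    using k(2) \<eta>'(1)[OF f] Garr[OF m] by (simp add: hom_def)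
  finally have "on_arr G (on_arr F u) = on_arr G m"
    using A.iso_right_cancel[OF \<eta>'(2,1)[OF f] Garr[OF Farr[OF u]] Garr[OF m]] by blast
  then have "on_arr F u = m"
    using faithful[OF Farr[OF u] m] by blast
  then show thesis
    using that u by blast
qed

lemma equivalence_surj:
  assumes eq: "is_equivalence A B F" and q: "q \<in> Obj B"
  obtains p e where "p \<in> Obj A" "e \<in> hom B (on_obj F p) q" "iso B e"
proof -
  obtain G \<epsilon> where G: "is_functor B A G" and \<epsilon>: "nat_iso B B (comp_fctr F G) id_fctr \<epsilon>"
    using eq by (auto simp: is_equivalence_def)
  then show thesis
    using that[of "on_obj G q" "\<epsilon> q"] q
    by (auto simp: nat_iso_def is_functor_def id_fctr_def comp_fctr_def)
qed


section \<open>Coproducts\<close>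

definition is_initial :: "('o, 'm) cat \<Rightarrow> 'o \<Rightarrow> bool" where
  "is_initial V Z \<longleftrightarrow> Z \<in> Obj V \<and> (\<forall>Y \<in> Obj V. \<exists>!f. f \<in> hom V Z Y)"

text \<open>A family enters a chosen coproduct only through the predicate that the choice is made from.
  This identifies the coproducts of families that differ off the index set, which happens
  for the extensional families of \<^const>\<open>prod_cat\<close>.\<close>

lemma coprod_cong:
  assumes "\<forall>i \<in> I. X i = Y i"
  shows "coprod V I X = coprod V I Y" "incl V I X = incl V I Y"
proof -
  have "is_coproduct V I X = is_coproduct V I Y"
    using assms by (auto simp: is_coproduct_def fun_eq_iff)
  then show "coprod V I X = coprod V I Y" "incl V I X = incl V I Y"
    by (simp_all add: coprod_def incl_def coprod_cocone_def)
qed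

lemma coprod_map_cong:
  assumes "\<forall>i \<in> I. X i = X' i" "\<forall>i \<in> I. Y i = Y' i" "\<forall>i \<in> I. f i = f' i"
  shows "coprod_map V I X Y f = coprod_map V I X' Y' f'"
  using assms(3)
  by (simp add: coprod_map_def cotuple_def coprod_cong[OF assms(1)] coprod_cong[OF assms(2)])

lemma chosen_coproduct:
  assumes "is_coproduct V I X S \<iota>"
  shows "is_coproduct V I X (coprod V I X) (incl V I X)"
proof -
  have "case coprod_cocone V I X of (S, \<iota>) \<Rightarrow> is_coproduct V I X S \<iota>"
    unfolding coprod_cocone_def by (rule someI[of _ "(S, \<iota>)"]) (simp add: assms)
  then show ?thesis
    by (simp add: coprod_def incl_def split: prod.splits)
qed

lemma coproduct_induced:
  assumes "is_coproduct V I X S \<iota>" "Z \<in> Obj V" "\<forall>i \<in> I. f i \<in> hom V (X i) Z"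
  obtains h where "h \<in> hom V S Z" "\<And>i. i \<in> I \<Longrightarrow> h \<cdot>\<^bsub>V\<^esub> \<iota> i = f i"
  using assms(1)[unfolded is_coproduct_def, THEN conjunct2, THEN conjunct2, rule_format, OF assms(2), of f] assms(3)
  by blast

lemma coproduct_incl:
  "\<lbrakk>is_coproduct V I X S \<iota>; i \<in> I\<rbrakk> \<Longrightarrow> \<iota> i \<in> hom V (X i) S"
  by (simp add: is_coproduct_def)

lemma (in category) coproduct_eqI:
  assumes "is_coproduct V I X S \<iota>" "h \<in> hom V S Z" "k \<in> hom V S Z"
    and "\<And>i. i \<in> I \<Longrightarrow> h \<cdot> \<iota> i = k \<cdot> \<iota> i"
  shows "h = k"
proof -
  have "Z \<in> Obj V" "\<forall>i\<in>I. h \<cdot> \<iota> i \<in> hom V (X i) Z"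
    using hom_Obj[OF assms(2)] coproduct_incl[OF assms(1)] Comp_in assms(2) by blast+
  then have "\<exists>!l. l \<in> hom V S Z \<and> (\<forall>i \<in> I. l \<cdot> \<iota> i = h \<cdot> \<iota> i)"
    using assms(1)[unfolded is_coproduct_def, THEN conjunct2, THEN conjunct2, rule_format, of Z "\<lambda>i. h \<cdot> \<iota> i"]
    by blast
  then show ?thesis
    using assms(2-4) by metis
qed

lemma cotuple:
  assumes "is_coproduct V I X S \<iota>" "Z \<in> Obj V" "\<forall>i \<in> I. f i \<in> hom V (X i) Z"
  shows "cotuple V I X Z f \<in> hom V (coprod V I X) Z"
    and "\<And>i. i \<in> I \<Longrightarrow> cotuple V I X Z f \<cdot>\<^bsub>V\<^esub> incl V I X i = f i"
proof -
  have "\<exists>!h. h \<in> hom V (coprod V I X) Z \<and> (\<forall>i \<in> I. h \<cdot>\<^bsub>V\<^esub> incl V I X i = f i)"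
    using chosen_coproduct[OF assms(1)] assms(2,3) by (simp add: is_coproduct_def)
  from theI'[OF this]
  show "cotuple V I X Z f \<in> hom V (coprod V I X) Z"
    and "\<And>i. i \<in> I \<Longrightarrow> cotuple V I X Z f \<cdot>\<^bsub>V\<^esub> incl V I X i = f i"
    by (auto simp: cotuple_def)
qed

text \<open>Extensivity speaks of index sets inside the bounding set only; this moves coproducts to the
  index sets \<open>VObj C\<close> and \<open>VObj C \<times> VObj C\<close>, which embed into it.\<close>

lemma coproduct_reindex:
  assumes inj: "inj_on p I" and S: "is_coproduct V (p ` I) (X \<circ> the_inv_into I p) S \<iota>"
  shows "is_coproduct V I X S (\<iota> \<circ> p)"
  unfolding is_coproduct_def
proof (intro conjI ballI allI impI)
  show "S \<in> Obj V" using S by (simp add: is_coproduct_def)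
next
  fix i assume "i \<in> I"
  then show "(\<iota> \<circ> p) i \<in> hom V (X i) S"
    using coproduct_incl[OF S, of "p i"] by (simp add: the_inv_into_f_f[OF inj])
next
  fix Z f assume Z: "Z \<in> Obj V" and f: "\<forall>i \<in> I. f i \<in> hom V (X i) Z"
  have "\<forall>j \<in> p ` I. (f \<circ> the_inv_into I p) j \<in> hom V ((X \<circ> the_inv_into I p) j) Z"
    using f by (simp add: the_inv_into_f_f[OF inj])
  then have "\<exists>!h. h \<in> hom V S Z \<and> (\<forall>j \<in> p ` I. h \<cdot>\<^bsub>V\<^esub> \<iota> j = (f \<circ> the_inv_into I p) j)"
    using S[unfolded is_coproduct_def, THEN conjunct2, THEN conjunct2, rule_format, OF Z, of "f \<circ> the_inv_into I p"]
    by blast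
  then show "\<exists>!h. h \<in> hom V S Z \<and> (\<forall>i \<in> I. h \<cdot>\<^bsub>V\<^esub> (\<iota> \<circ> p) i = f i)"
    by (simp add: the_inv_into_f_f[OF inj])
qed

context category
begin

lemma coproduct_unique:
  assumes S: "is_coproduct V I X S \<iota>" and S': "is_coproduct V I X S' \<iota>'"
  obtains e where "e \<in> hom V S S'" "iso V e" "\<And>i. i \<in> I \<Longrightarrow> e \<cdot> \<iota> i = \<iota>' i"
proof -
  have obj: "S \<in> Obj V" "S' \<in> Obj V"
    using S S' by (simp_all add: is_coproduct_def)
  note \<iota> = coproduct_incl[OF S] and \<iota>' = coproduct_incl[OF S']
  obtain e where e: "e \<in> hom V S S'" "\<And>i. i \<in> I \<Longrightarrow> e \<cdot> \<iota> i = \<iota>' i"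
    using coproduct_induced[OF S obj(2), of \<iota>'] \<iota>' by blast
  obtain k where k: "k \<in> hom V S' S" "\<And>i. i \<in> I \<Longrightarrow> k \<cdot> \<iota>' i = \<iota> i"
    using coproduct_induced[OF S' obj(1), of \<iota>] \<iota> by blast
  have "k \<cdot> e = Ident V S"
  proof (rule coproduct_eqI[OF S Comp_in[OF e(1) k(1)] Ident_in[OF obj(1)]])
    fix i assume "i \<in> I"
    then show "(k \<cdot> e) \<cdot> \<iota> i = Ident V S \<cdot> \<iota> i"
      using \<iota>[of i] e k(1) k(2)[of i] by (simp add: hom_def)
  qed
  moreover have "e \<cdot> k = Ident V S'"
  proof (rule coproduct_eqI[OF S' Comp_in[OF k(1) e(1)] Ident_in[OF obj(2)]])
    fix i assume "i \<in> I"
    then show "(e \<cdot> k) \<cdot> \<iota>' i = Ident V S' \<cdot> \<iota>' i"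
      using \<iota>'[of i] k e(1) e(2)[of i] by (simp add: hom_def)
  qed
  ultimately show thesis
    using that e isoI[OF e(1) k(1)] by blast
qed

lemma coproduct_iso:
  assumes S: "is_coproduct V I X S \<iota>" and e: "e \<in> hom V S S'" "iso V e"
  shows "is_coproduct V I X S' (\<lambda>i. e \<cdot> \<iota> i)"
proof -
  note \<iota> = coproduct_incl[OF S]
  obtain k where k: "k \<in> hom V S' S" "k \<cdot> e = Ident V S" "e \<cdot> k = Ident V S'"
    using isoE[OF e(2,1)] by blast
  show ?thesis
    unfolding is_coproduct_def
  proof (intro conjI ballI allI impI)
    show "S' \<in> Obj V" using hom_Obj[OF e(1)] by blast
  next
    fix i assume "i \<in> I"
    then show "e \<cdot> \<iota> i \<in> hom V (X i) S'" using Comp_in[OF \<iota> e(1)] by blast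
  next
    fix Z f assume Z: "Z \<in> Obj V" and f: "\<forall>i \<in> I. f i \<in> hom V (X i) Z"
    obtain h where h: "h \<in> hom V S Z" "\<And>i. i \<in> I \<Longrightarrow> h \<cdot> \<iota> i = f i"
      using coproduct_induced[OF S Z] f by metis
    show "\<exists>!h. h \<in> hom V S' Z \<and> (\<forall>i \<in> I. h \<cdot> (e \<cdot> \<iota> i) = f i)"
    proof (rule ex1I)
      have "(h \<cdot> k) \<cdot> (e \<cdot> \<iota> i) = f i" if "i \<in> I" for i
      proof -
        have "(h \<cdot> k) \<cdot> (e \<cdot> \<iota> i) = h \<cdot> ((k \<cdot> e) \<cdot> \<iota> i)"
          using h(1) k(1) e(1) \<iota>[OF that] by (simp add: hom_def)
        then show ?thesis
          using h(2) \<iota>[OF that] that k(2) by (simp add: hom_def)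
      qed
      then show "h \<cdot> k \<in> hom V S' Z \<and> (\<forall>i \<in> I. (h \<cdot> k) \<cdot> (e \<cdot> \<iota> i) = f i)"
        using Comp_in[OF k(1) h(1)] by blast
    next
      fix l assume l: "l \<in> hom V S' Z \<and> (\<forall>i \<in> I. l \<cdot> (e \<cdot> \<iota> i) = f i)"
      have "l \<cdot> e = h"
      proof (rule coproduct_eqI[OF S])
        show "l \<cdot> e \<in> hom V S Z" "h \<in> hom V S Z" using l e h Comp_in by blast+
        fix i assume "i \<in> I"
        then show "(l \<cdot> e) \<cdot> \<iota> i = h \<cdot> \<iota> i"
          using l e(1) \<iota>[of i] h(2) by (simp add: hom_def)
      qed
      then have "h \<cdot> k = l \<cdot> (e \<cdot> k)"
        using l e(1) k(1) by (auto simp: hom_def)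
      then show "l = h \<cdot> k"
        using l k(3) by (simp add: hom_def)
    qed
  qed
qed

end


section \<open>Products, exponentials and pullbacks\<close>

lemma chosen_product:
  assumes "is_product V X Y P p q"
  shows "is_product V X Y (prd V X Y) (prj1 V X Y) (prj2 V X Y)"
proof -
  have "case prod_cone V X Y of (P, p, q) \<Rightarrow> is_product V X Y P p q"
    unfolding prod_cone_def by (rule someI[of _ "(P, p, q)"]) (simp add: assms)
  then show ?thesis
    by (simp add: prd_def prj1_def prj2_def split: prod.splits)
qed

lemma chosen_exponential:
  assumes "is_exponential V X Y E e"
  shows "is_exponential V X Y (ihom V X Y) (evl V X Y)"
proof -
  have "case exp_cone V X Y of (E, e) \<Rightarrow> is_exponential V X Y E e"
    unfolding exp_cone_def by (rule someI[of _ "(E, e)"]) (simp add: assms)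
  then show ?thesis
    by (simp add: ihom_def evl_def split: prod.splits)
qed

lemma chosen_pullback:
  assumes "is_pullback V f g P p q"
  shows "is_pullback V f g (pb V f g) (pb1 V f g) (pb2 V f g)"
proof -
  have "case pb_cone V f g of (P, p, q) \<Rightarrow> is_pullback V f g P p q"
    unfolding pb_cone_def by (rule someI[of _ "(P, p, q)"]) (simp add: assms)
  then show ?thesis
    by (simp add: pb_def pb1_def pb2_def split: prod.splits)
qed

locale cartesian_closed_category = category V for V :: "('o, 'm) cat" (structure) +
  assumes cartesian_closed: "cartesian_closed V"
begin

lemma one_terminal: "is_terminal V (one V)"
  using cartesian_closed someI_ex[of "is_terminal V"]
  by (auto simp: cartesian_closed_def one_def)

lemma one_Obj [simp]: "one V \<in> Obj V"
  using one_terminal by (simp add: is_terminal_def)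

lemma bang_in: "X \<in> Obj V \<Longrightarrow> bang V X \<in> hom V X (one V)"
  using one_terminal theI'[of "\<lambda>f. f \<in> hom V X (one V)"]
  by (simp add: is_terminal_def bang_def)

lemma to_one_eq: "\<lbrakk>f \<in> hom V X (one V); g \<in> hom V X (one V)\<rbrakk> \<Longrightarrow> f = g"
  using one_terminal hom_Obj[of f X "one V"] by (auto simp: is_terminal_def)

lemma bang_simps [simp]:
  assumes "X \<in> Obj V"
  shows "bang V X \<in> Arr V" "Dom V (bang V X) = X" "Cod V (bang V X) = one V"
  using bang_in[OF assms] by (simp_all add: hom_def)

lemma bang_Comp [simp]:
  "\<lbrakk>f \<in> Arr V; Cod V f = X\<rbrakk> \<Longrightarrow> bang V X \<cdot> f = bang V (Dom V f)"
  using Dom_in[of f] Cod_in[of f] by (intro to_one_eq[of _ "Dom V f"]) (auto simp: hom_def)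

lemma bang_one [simp]: "bang V (one V) = Ident V (one V)"
  by (rule to_one_eq[of _ "one V"]) (auto simp: hom_def)

lemma product:
  assumes "X \<in> Obj V" "Y \<in> Obj V"
  shows "is_product V X Y (prd V X Y) (prj1 V X Y) (prj2 V X Y)"
  using cartesian_closed assms chosen_product unfolding cartesian_closed_def by metis

lemma prj_simps [simp]:
  assumes "X \<in> Obj V" "Y \<in> Obj V"
  shows "prj1 V X Y \<in> Arr V" "Dom V (prj1 V X Y) = prd V X Y" "Cod V (prj1 V X Y) = X"
    and "prj2 V X Y \<in> Arr V" "Dom V (prj2 V X Y) = prd V X Y" "Cod V (prj2 V X Y) = Y"
  using product[OF assms] by (simp_all add: is_product_def hom_def)

lemma prd_Obj [simp]: "\<lbrakk>X \<in> Obj V; Y \<in> Obj V\<rbrakk> \<Longrightarrow> prd V X Y \<in> Obj V"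
  using Dom_in[of "prj1 V X Y"] by simp

lemma tuple_ex1:
  assumes "f \<in> Arr V" "g \<in> Arr V" "Dom V g = Dom V f"
  shows "\<exists>!h. h \<in> hom V (Dom V f) (prd V (Cod V f) (Cod V g)) \<and>
    prj1 V (Cod V f) (Cod V g) \<cdot> h = f \<and> prj2 V (Cod V f) (Cod V g) \<cdot> h = g"
proof -
  have "f \<in> hom V (Dom V f) (Cod V f)" "g \<in> hom V (Dom V f) (Cod V g)"
    using assms by (simp_all add: hom_def)
  then show ?thesis
    using product[OF Cod_in Cod_in, OF assms(1,2)] unfolding is_product_def by blast
qed

lemma tuple_simps [simp]:
  assumes "f \<in> Arr V" "g \<in> Arr V" "Dom V g = Dom V f"
  shows "tuple V f g \<in> Arr V" "Dom V (tuple V f g) = Dom V f"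
    and "Cod V (tuple V f g) = prd V (Cod V f) (Cod V g)"
  using theI'[OF tuple_ex1[OF assms]] by (simp_all add: tuple_def hom_def)

lemma prj_tuple [simp]:
  assumes "f \<in> Arr V" "g \<in> Arr V" "Dom V g = Dom V f" "Cod V f = X" "Cod V g = Y"
  shows "prj1 V X Y \<cdot> tuple V f g = f" "prj2 V X Y \<cdot> tuple V f g = g"
  using theI'[OF tuple_ex1[OF assms(1-3)]] assms(4,5) by (simp_all add: tuple_def)

lemma prd_eqI:
  assumes "h \<in> hom V Z (prd V X Y)" "k \<in> hom V Z (prd V X Y)" "X \<in> Obj V" "Y \<in> Obj V"
    and "prj1 V X Y \<cdot> h = prj1 V X Y \<cdot> k" "prj2 V X Y \<cdot> h = prj2 V X Y \<cdot> k"
  shows "h = k"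
proof -
  have "prj1 V X Y \<cdot> h \<in> hom V Z X" "prj2 V X Y \<cdot> h \<in> hom V Z Y"
    using assms(1,3,4) by (simp_all add: hom_def)
  then have "\<exists>!l. l \<in> hom V Z (prd V X Y) \<and>
      prj1 V X Y \<cdot> l = prj1 V X Y \<cdot> h \<and> prj2 V X Y \<cdot> l = prj2 V X Y \<cdot> h"
    using product[OF assms(3,4)] unfolding is_product_def by blast
  then show ?thesis
    using assms(1,2,5,6) by metis
qed

lemma tuple_Comp [simp]:
  assumes "f \<in> Arr V" "g \<in> Arr V" "Dom V g = Dom V f" "h \<in> Arr V" "Cod V h = Dom V f"
  shows "tuple V f g \<cdot> h = tuple V (f \<cdot> h) (g \<cdot> h)"
proof (rule prd_eqI[of _ "Dom V h" "Cod V f" "Cod V g"])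
  have "prj1 V (Cod V f) (Cod V g) \<cdot> (tuple V f g \<cdot> h) = (prj1 V (Cod V f) (Cod V g) \<cdot> tuple V f g) \<cdot> h"
    "prj2 V (Cod V f) (Cod V g) \<cdot> (tuple V f g \<cdot> h) = (prj2 V (Cod V f) (Cod V g) \<cdot> tuple V f g) \<cdot> h"
    using assms Cod_in[of f] Cod_in[of g] by (simp_all del: prj_tuple)
  then show "prj1 V (Cod V f) (Cod V g) \<cdot> (tuple V f g \<cdot> h)
      = prj1 V (Cod V f) (Cod V g) \<cdot> tuple V (f \<cdot> h) (g \<cdot> h)"
    "prj2 V (Cod V f) (Cod V g) \<cdot> (tuple V f g \<cdot> h)
      = prj2 V (Cod V f) (Cod V g) \<cdot> tuple V (f \<cdot> h) (g \<cdot> h)"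
    using assms by simp_all
qed (use assms Cod_in in \<open>auto simp: hom_def\<close>)

lemma tuple_prj:
  assumes "h \<in> hom V Z (prd V X Y)" "X \<in> Obj V" "Y \<in> Obj V"
  shows "h = tuple V (prj1 V X Y \<cdot> h) (prj2 V X Y \<cdot> h)"
  using assms by - (rule prd_eqI[of _ Z X Y]; simp add: hom_def)

lemma pmap_simps [simp]:
  assumes "f \<in> Arr V" "g \<in> Arr V"
  shows "pmap V f g \<in> Arr V" "Dom V (pmap V f g) = prd V (Dom V f) (Dom V g)"
    and "Cod V (pmap V f g) = prd V (Cod V f) (Cod V g)"
  using assms Dom_in by (simp_all add: pmap_def)

lemma pmap_tuple [simp]:
  assumes "f \<in> Arr V" "g \<in> Arr V" "a \<in> Arr V" "b \<in> Arr V" "Dom V b = Dom V a"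
    and "Dom V f = Cod V a" "Dom V g = Cod V b"
  shows "pmap V f g \<cdot> tuple V a b = tuple V (f \<cdot> a) (g \<cdot> b)"
  using assms Dom_in[of f] Dom_in[of g] by (simp add: pmap_def)

lemma swap_simps [simp]:
  assumes "X \<in> Obj V" "Y \<in> Obj V"
  shows "swap V X Y \<in> Arr V" "Dom V (swap V X Y) = prd V X Y" "Cod V (swap V X Y) = prd V Y X"
  using assms by (simp_all add: swap_def)

lemma swap_tuple [simp]:
  assumes "a \<in> Arr V" "b \<in> Arr V" "Dom V b = Dom V a" "Cod V a = X" "Cod V b = Y"
  shows "swap V X Y \<cdot> tuple V a b = tuple V b a"
  using assms Cod_in[of a] Cod_in[of b] by (simp add: swap_def)

lemma exponential:
  assumes "X \<in> Obj V" "Y \<in> Obj V"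
  shows "is_exponential V X Y (ihom V X Y) (evl V X Y)"
  using cartesian_closed assms chosen_exponential unfolding cartesian_closed_def by metis

lemma evl_simps [simp]:
  assumes "X \<in> Obj V" "Y \<in> Obj V"
  shows "ihom V X Y \<in> Obj V"
    and "evl V X Y \<in> Arr V" "Dom V (evl V X Y) = prd V X (ihom V X Y)" "Cod V (evl V X Y) = Y"
  using exponential[OF assms] by (simp_all add: is_exponential_def hom_def)

lemma transp_ex1:
  assumes "f \<in> Arr V" "Dom V f = prd V X Z" "X \<in> Obj V" "Z \<in> Obj V"
  shows "\<exists>!g. g \<in> hom V Z (ihom V X (Cod V f)) \<and>
    evl V X (Cod V f) \<cdot> pmap V (Ident V X) g = f"
proof -
  have "f \<in> hom V (prd V X Z) (Cod V f)"
    using assms by (simp add: hom_def)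
  then show ?thesis
    using exponential[OF assms(3) Cod_in[OF assms(1)]] assms(4) unfolding is_exponential_def by blast
qed

lemma transp_simps [simp]:
  assumes "f \<in> Arr V" "Dom V f = prd V X Z" "X \<in> Obj V" "Z \<in> Obj V"
  shows "transp V X Z f \<in> Arr V" "Dom V (transp V X Z f) = Z"
    and "Cod V (transp V X Z f) = ihom V X (Cod V f)"
  using theI'[OF transp_ex1[OF assms]] by (simp_all add: transp_def hom_def)

lemma evl_transp:
  assumes "f \<in> Arr V" "Dom V f = prd V X Z" "X \<in> Obj V" "Z \<in> Obj V"
  shows "evl V X (Cod V f) \<cdot> pmap V (Ident V X) (transp V X Z f) = f"
  using theI'[OF transp_ex1[OF assms]] by (simp add: transp_def)

lemma evl_tuple_transp [simp]:
  assumes "f \<in> Arr V" "Dom V f = prd V X Z" "Cod V f = Y" "Z \<in> Obj V"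
    and "a \<in> Arr V" "Cod V a = X" "h \<in> Arr V" "Dom V h = Dom V a" "Cod V h = Z"
  shows "evl V X Y \<cdot> tuple V a (transp V X Z f \<cdot> h) = f \<cdot> tuple V a h"
proof -
  have X: "X \<in> Obj V" using Cod_in[of a] assms by simp
  have Y: "Y \<in> Obj V" using Cod_in[of f] assms by simp
  have "(evl V X Y \<cdot> pmap V (Ident V X) (transp V X Z f)) \<cdot> tuple V a h = f \<cdot> tuple V a h"
    using evl_transp[of f X Z] assms X by simp
  then show ?thesis
    using assms X Y by simp
qed

text \<open>Global elements of \<open>[X, Y]\<close> are determined by the maps from \<open>X\<close> to \<open>Y\<close> that they name;
  with the next lemma, the two are in bijection.\<close>

lemma element_of_ihom_eqI:
  assumes g: "g \<in> hom V (one V) (ihom V X Y)" "g' \<in> hom V (one V) (ihom V X Y)"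
    and XY: "X \<in> Obj V" "Y \<in> Obj V"
    and eq: "evl V X Y \<cdot> tuple V (Ident V X) (g \<cdot> bang V X)
      = evl V X Y \<cdot> tuple V (Ident V X) (g' \<cdot> bang V X)"
  shows "g = g'"
proof -
  have bang: "bang V (prd V X (one V)) = prj2 V X (one V)"
    using XY by (intro to_one_eq[of _ "prd V X (one V)"]) (auto simp: hom_def)
  have *: "evl V X Y \<cdot> pmap V (Ident V X) k
      = (evl V X Y \<cdot> tuple V (Ident V X) (k \<cdot> bang V X)) \<cdot> prj1 V X (one V)"
    if "k \<in> hom V (one V) (ihom V X Y)" for k
    using that XY by (simp add: hom_def pmap_def bang)
  have "evl V X Y \<cdot> pmap V (Ident V X) g \<in> hom V (prd V X (one V)) Y"
    using g XY by (simp add: hom_def)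
  then have "\<exists>!l. l \<in> hom V (one V) (ihom V X Y) \<and>
      evl V X Y \<cdot> pmap V (Ident V X) l = evl V X Y \<cdot> pmap V (Ident V X) g"
    using exponential[OF XY] one_Obj unfolding is_exponential_def by blast
  then show ?thesis
    using g *[OF g(1)] *[OF g(2)] eq by metis
qed

lemma name_of_map:
  assumes "h \<in> hom V X Y"
  obtains v where "v \<in> hom V (one V) (ihom V X Y)"
    "evl V X Y \<cdot> tuple V (Ident V X) (v \<cdot> bang V X) = h"
proof
  have "X \<in> Obj V" using hom_Obj[OF assms] by simp
  then show "transp V X (one V) (h \<cdot> prj1 V X (one V)) \<in> hom V (one V) (ihom V X Y)"
    and "evl V X Y \<cdot> tuple V (Ident V X) (transp V X (one V) (h \<cdot> prj1 V X (one V)) \<cdot> bang V X) = h"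
    using assms by (simp_all add: hom_def)
qed

text \<open>A map \<open>w\<close> from \<open>W\<close> to an initial \<open>Z\<close> exhibits \<open>W\<close> as a retract of \<open>W \<times> Z\<close>, so a map
  out of \<open>W\<close> is recovered from its restriction to \<open>W \<times> Z\<close>.  The transpose of that restriction
  is a map out of \<open>Z\<close>, of which there is only one.\<close>

lemma strict_initial:
  assumes Z: "is_initial V Z" and w: "w \<in> hom V W Z"
  shows "is_initial V W"
proof -
  have obj: "W \<in> Obj V" "Z \<in> Obj V" using hom_Obj[OF w] by simp_all
  have "\<exists>!f. f \<in> hom V W Y" if Y: "Y \<in> Obj V" for Y
  proof (rule ex_ex1I)
    obtain z where "z \<in> hom V Z Y" using Z Y by (auto simp: is_initial_def)
    then show "\<exists>f. f \<in> hom V W Y" using Comp_in[OF w] by blast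
  next
    fix f g assume f: "f \<in> hom V W Y" and g: "g \<in> hom V W Y"
    define T where "T u = transp V W Z (u \<cdot> prj1 V W Z)" for u
    have T: "T u \<in> hom V Z (ihom V W Y)" if "u \<in> hom V W Y" for u
      using that obj by (simp add: T_def hom_def)
    have u: "u = evl V W Y \<cdot> tuple V (Ident V W) (T u \<cdot> w)" if "u \<in> hom V W Y" for u
      using that obj w by (simp add: T_def hom_def)
    have "T f = T g"
      using T[OF f] T[OF g] Z evl_simps(1)[OF obj(1) Y] unfolding is_initial_def by blast
    then show "f = g" using u[OF f] u[OF g] by simp
  qed
  then show ?thesis using obj by (simp add: is_initial_def)
qed

end


section \<open>Extensivity\<close>

lemma (in category) coprod_map:
  assumes Y: "is_coproduct V I Y P \<kappa>" and X: "is_coproduct V I X S \<iota>"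
    and f: "\<forall>i \<in> I. f i \<in> hom V (Y i) (X i)"
  shows "coprod_map V I Y X f \<in> hom V (coprod V I Y) (coprod V I X)"
    and "\<And>i. i \<in> I \<Longrightarrow> coprod_map V I Y X f \<cdot> incl V I Y i = incl V I X i \<cdot> f i"
proof -
  note X' = chosen_coproduct[OF X]
  have "coprod V I X \<in> Obj V" "\<forall>i \<in> I. incl V I X i \<cdot> f i \<in> hom V (Y i) (coprod V I X)"
    using X' f Comp_in by (auto simp: is_coproduct_def)
  from cotuple[OF Y this]
  show "coprod_map V I Y X f \<in> hom V (coprod V I Y) (coprod V I X)"
    and "\<And>i. i \<in> I \<Longrightarrow> coprod_map V I Y X f \<cdot> incl V I Y i = incl V I X i \<cdot> f i"
    by (simp_all add: coprod_map_def)
qed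

lemma iso_of_slice_iso:
  assumes "iso (slice V X) (f, k, g)"
  shows "iso V k"
proof -
  let ?S = "slice V X"
  have t: "k \<in> hom V (Dom V f) (Dom V g)"
    using assms by (simp add: iso_def slice_def)
  obtain f' l g' where inv: "(g', l, f') \<in> hom ?S (Cod ?S (f, k, g)) (Dom ?S (f, k, g))"
    "(g', l, f') \<cdot>\<^bsub>?S\<^esub> (f, k, g) = Ident ?S (Dom ?S (f, k, g))"
    "(f, k, g) \<cdot>\<^bsub>?S\<^esub> (g', l, f') = Ident ?S (Cod ?S (f, k, g))"
    using assms unfolding iso_def by (metis prod_cases3)
  have "l \<in> hom V (Dom V g) (Dom V f)"
    using inv(1) by (simp add: slice_def hom_def) 
  moreover have "l \<cdot>\<^bsub>V\<^esub> k = Ident V (Dom V f)" "k \<cdot>\<^bsub>V\<^esub> l = Ident V (Dom V g)"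
    using inv(2,3) by (simp_all add: slice_def)
  ultimately show ?thesis
    using t by (auto simp: iso_def hom_def)
qed

locale extensive_ccc = cartesian_closed_category V for V :: "('o, 'm) cat" (structure) +
  fixes U :: "'u set"
  assumes extensive: "extensive U V"
begin

lemma coproduct:
  assumes "I \<lesssim> U" "\<forall>i \<in> I. X i \<in> Obj V"
  shows "is_coproduct V I X (coprod V I X) (incl V I X)"
proof -
  obtain p where p: "inj_on p I" "p ` I \<subseteq> U"
    using assms(1) by (auto simp: lepoll_def)
  have "\<forall>j \<in> p ` I. (X \<circ> the_inv_into I p) j \<in> Obj V"
    using assms(2) by (auto simp: the_inv_into_f_f[OF p(1)])
  then obtain S \<iota> where "is_coproduct V (p ` I) (X \<circ> the_inv_into I p) S \<iota>"
    using extensive[unfolded extensive_def, rule_format, OF p(2), of "X \<circ> the_inv_into I p"] by blast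
  then show ?thesis
    by (rule chosen_coproduct[OF coproduct_reindex[OF p(1)]])
qed

lemma initial_exists: "\<exists>Z. is_initial V Z"
proof -
  obtain S and \<iota> :: "'u \<Rightarrow> 'm" where "is_coproduct V {} (\<lambda>_. one V) S \<iota>"
    using extensive unfolding extensive_def by blast
  then have "is_initial V S"
    by (simp add: is_coproduct_def is_initial_def)
  then show ?thesis by blast
qed

text \<open>Apart from the existence of coproducts, extensivity enters through this lemma, which is
  fullness of the coproduct functor on slices without its encoding, and through \<open>chosen_coproduct_decompose\<close>, which is its essential
  surjectivity.\<close>

lemma slice_coprod_full:
  assumes I: "I \<subseteq> U" and f: "\<forall>i \<in> I. f i \<in> hom V (Y i) (X i)"
    and g: "\<forall>i \<in> I. g i \<in> hom V (Y' i) (X i)"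
    and m: "m \<in> hom V (coprod V I Y) (coprod V I Y')"
    and over: "coprod_map V I Y' X g \<cdot> m = coprod_map V I Y X f"
  shows "\<exists>u. \<forall>i \<in> I. u i \<in> hom V (Y i) (Y' i) \<and> g i \<cdot> u i = f i \<and>
    m \<cdot> incl V I Y i = incl V I Y' i \<cdot> u i"
proof -
  have objs: "\<forall>i \<in> I. X i \<in> Obj V" "\<forall>i \<in> I. Y i \<in> Obj V" "\<forall>i \<in> I. Y' i \<in> Obj V"
    using hom_Obj f g by blast+
  have small: "I \<lesssim> U" by (rule subset_imp_lepoll[OF I])
  note X = coproduct[OF small objs(1)] and Y = coproduct[OF small objs(2)]
    and Y' = coproduct[OF small objs(3)]
  define K where "K = prod_cat I (\<lambda>i. slice V (X i))"
  define L where "L = slice V (coprod V I X)"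
  have eq: "is_equivalence K L (slice_coprod V I X)"
    using extensive I objs(1) unfolding extensive_def K_def L_def by blast
  have obj: "restrict h I \<in> Obj K"
      "on_obj (slice_coprod V I X) (restrict h I) = coprod_map V I W X h"
    if h: "\<forall>i \<in> I. h i \<in> hom V (W i) (X i)" for h W
  proof -
    show "restrict h I \<in> Obj K"
      using h by (auto simp: K_def prod_cat_def slice_def hom_def)
    have "coprod_map V I (\<lambda>i. Dom V (restrict h I i)) X (restrict h I) = coprod_map V I W X h"
      using h by (intro coprod_map_cong) (auto simp: hom_def)
    then show "on_obj (slice_coprod V I X) (restrict h I) = coprod_map V I W X h"
      by (simp add: slice_coprod_def)
  qed
  have "(coprod_map V I Y X f, m, coprod_map V I Y' X g) \<in>
      hom L (on_obj (slice_coprod V I X) (restrict f I)) (on_obj (slice_coprod V I X) (restrict g I))"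
    using coprod_map(1)[OF Y X f] coprod_map(1)[OF Y' X g] m over
    by (simp add: obj(2)[OF f] obj(2)[OF g] L_def slice_def hom_def)
  then obtain w where w: "w \<in> hom K (restrict f I) (restrict g I)"
      and w_arr: "on_arr (slice_coprod V I X) w = (coprod_map V I Y X f, m, coprod_map V I Y' X g)"
    using equivalence_full[OF eq obj(1)[OF f] obj(1)[OF g]] by blast
  have w_ends: "fst (w i) = f i" "snd (snd (w i)) = g i" if "i \<in> I" for i
  proof -
    have "(\<lambda>i\<in>I. fst (w i)) = restrict f I" "(\<lambda>i\<in>I. snd (snd (w i))) = restrict g I"
      using w by (simp_all add: K_def prod_cat_def slice_def hom_def case_prod_beta)
    then show "fst (w i) = f i" "snd (snd (w i)) = g i"
      using that by (metis restrict_apply')+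
  qed
  define u where "u i = fst (snd (w i))" for i
  have u: "u i \<in> hom V (Y i) (Y' i)" "g i \<cdot> u i = f i" if "i \<in> I" for i
  proof -
    have "w i \<in> Arr (slice V (X i))"
      using w that by (auto simp: K_def prod_cat_def hom_def)
    then show "u i \<in> hom V (Y i) (Y' i)" "g i \<cdot> u i = f i"
      using w_ends[OF that] f g that
      by (simp_all add: u_def slice_def hom_def case_prod_beta)
  qed
  have "m = coprod_map V I (\<lambda>i. Dom V (fst (w i))) (\<lambda>i. Dom V (snd (snd (w i)))) (\<lambda>i. fst (snd (w i)))"
    using w_arr by (simp add: slice_coprod_def Let_def)
  also have "\<dots> = coprod_map V I Y Y' u"
    using w_ends f g by (intro coprod_map_cong) (auto simp: u_def hom_def)
  finally have m_incl: "m \<cdot> incl V I Y i = incl V I Y' i \<cdot> u i" if "i \<in> I" for i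
    using coprod_map(2)[OF Y Y', of u] u(1) that by simp
  with u show ?thesis by blast
qed

text \<open>Both properties come from one use of fullness.  Let \<open>h\<close> and \<open>k\<close> become equal in the
  coproduct.  Extend each to a family over all the \<open>X l\<close> whose domain at every other index is an initial
  object.  Both coproducts of domains are copies of \<open>W\<close>, and the identification of the copies
  is a map over the coproduct of the \<open>X l\<close>, hence comes from a family \<open>u\<close>.  If \<open>i = j\<close>, then
  \<open>u i\<close> is the identity, so that \<open>h = k\<close>; otherwise \<open>u i\<close> maps \<open>W\<close> to an initial object.\<close>

lemma chosen_coproduct_mono_or_disjoint:
  assumes I: "I \<subseteq> U" and X: "\<forall>i \<in> I. X i \<in> Obj V" and ij: "i \<in> I" "j \<in> I"
    and h: "h \<in> hom V W (X i)" and k: "k \<in> hom V W (X j)"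
    and eq: "incl V I X i \<cdot> h = incl V I X j \<cdot> k"
  shows "if i = j then h = k else is_initial V W"
proof -
  obtain Z where Z: "is_initial V Z" using initial_exists by blast
  define z where "z A = (THE f. f \<in> hom V Z A)" for A
  have z: "z A \<in> hom V Z A" if "A \<in> Obj V" for A
    using Z that theI'[of "\<lambda>f. f \<in> hom V Z A"] by (simp add: is_initial_def z_def)
  have Z_eq: "a = b" if "a \<in> hom V Z A" "b \<in> hom V Z A" for a b A
    using Z that hom_Obj[OF that(1)] by (auto simp: is_initial_def)
  have W: "W \<in> Obj V" "Z \<in> Obj V" using hom_Obj[OF h] Z by (simp_all add: is_initial_def)
  \<comment> \<open>\<open>f i h\<close> is the family that is \<open>h\<close> at \<open>i\<close> and has domain \<open>Z\<close> elsewhere.\<close>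
  define Y where "Y i l = (if l = i then W else Z)" for i l :: 'u
  define f where "f i h l = (if l = i then h else z (X l))" for i l :: 'u and h
  have small: "I \<lesssim> U" by (rule subset_imp_lepoll[OF I])
  have Y: "is_coproduct V I (Y i) (coprod V I (Y i)) (incl V I (Y i))" for i
    using W by (intro coproduct[OF small]) (simp add: Y_def)
  note XX = coproduct[OF small X]
  have f: "\<forall>l \<in> I. f i h l \<in> hom V (Y i l) (X l)" if "h \<in> hom V W (X i)" for i h
    using that z X by (simp add: f_def Y_def)
  have f_at: "f i h i = h" for i h by (simp add: f_def)
  note \<kappa> = coproduct_incl[OF Y] and \<iota> = coproduct_incl[OF XX]
  have P: "coprod V I (Y i) \<in> Obj V" for i using Y by (simp add: is_coproduct_def)
  have jW: "incl V I (Y j) j \<in> hom V W (coprod V I (Y j))"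
    using \<kappa>[OF ij(2), of j] by (simp add: Y_def)
  have "\<forall>l \<in> I. (if l = i then incl V I (Y j) j else z (coprod V I (Y j))) \<in> hom V (Y i l) (coprod V I (Y j))"
    using jW z P by (simp add: Y_def)
  from coproduct_induced[OF Y P this]
  obtain m where m: "m \<in> hom V (coprod V I (Y i)) (coprod V I (Y j))"
    and m_incl: "\<And>l. l \<in> I \<Longrightarrow> m \<cdot> incl V I (Y i) l =
      (if l = i then incl V I (Y j) j else z (coprod V I (Y j)))"
    by blast
  note fi = coprod_map[OF Y XX f[OF h]] and gj = coprod_map[OF Y XX f[OF k]]
  have "coprod_map V I (Y j) X (f j k) \<cdot> m = coprod_map V I (Y i) X (f i h)"
  proof (rule coproduct_eqI[OF Y Comp_in[OF m gj(1)] fi(1)])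
    fix l assume l: "l \<in> I"
    have assoc: "(coprod_map V I (Y j) X (f j k) \<cdot> m) \<cdot> incl V I (Y i) l
        = coprod_map V I (Y j) X (f j k) \<cdot> (m \<cdot> incl V I (Y i) l)"
      using m gj(1) \<kappa>[OF l, of i] by (simp add: hom_def)
    show "(coprod_map V I (Y j) X (f j k) \<cdot> m) \<cdot> incl V I (Y i) l
        = coprod_map V I (Y i) X (f i h) \<cdot> incl V I (Y i) l"
    proof (cases "l = i")
      case True
      then show ?thesis
        using assoc m_incl[OF l] fi(2)[OF l] gj(2)[OF ij(2)] eq by (simp add: f_at)
    next
      case False
      then have "incl V I (Y i) l \<in> hom V Z (coprod V I (Y i))"
        using \<kappa>[OF l, of i] by (simp add: Y_def)
      then show ?thesis
        using Z_eq[OF Comp_in[OF _ Comp_in[OF m gj(1)]] Comp_in[OF _ fi(1)]] by blast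
    qed
  qed
  with slice_coprod_full[OF I f[OF h] f[OF k] m]
  obtain u where u: "\<And>l. l \<in> I \<Longrightarrow> u l \<in> hom V (Y i l) (Y j l)"
      "\<And>l. l \<in> I \<Longrightarrow> f j k l \<cdot> u l = f i h l"
      "\<And>l. l \<in> I \<Longrightarrow> m \<cdot> incl V I (Y i) l = incl V I (Y j) l \<cdot> u l"
    by blast
  show ?thesis
  proof (cases "i = j")
    case False
    then have "u i \<in> hom V W Z" using u(1)[OF ij(1)] by (simp add: Y_def)
    then show ?thesis using False strict_initial[OF Z] by simp
  next
    case True
    have ui: "u i \<in> hom V W W" "k \<cdot> u i = h" "incl V I (Y i) i = incl V I (Y i) i \<cdot> u i"
      using u(1-3)[OF ij(1)] m_incl[OF ij(1)] True by (simp_all add: Y_def f_def)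
    \<comment> \<open>A retraction of the inclusion at \<open>i\<close>, which shows that \<open>u i\<close> is the identity.\<close>
    have "\<forall>l \<in> I. (if l = i then Ident V W else z W) \<in> hom V (Y i l) W"
      using z W Ident_in by (simp add: Y_def)
    from coproduct_induced[OF Y W(1) this]
    obtain r where r: "r \<in> hom V (coprod V I (Y i)) W"
      and r_incl: "\<And>l. l \<in> I \<Longrightarrow> r \<cdot> incl V I (Y i) l = (if l = i then Ident V W else z W)"
      by blast
    have ri: "r \<cdot> incl V I (Y i) i = Ident V W"
      using r_incl[OF ij(1)] by simp
    have iW: "incl V I (Y i) i \<in> hom V W (coprod V I (Y i))" using jW True by simp
    have "u i = (r \<cdot> incl V I (Y i) i) \<cdot> u i"
      using ui(1) ri by (simp add: hom_def)
    also have "\<dots> = r \<cdot> (incl V I (Y i) i \<cdot> u i)"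
      using ui(1) r iW by (simp add: hom_def)
    also have "\<dots> = Ident V W"
      using ui(3) ri by simp
    finally show ?thesis using True ui(2) k by (simp add: hom_def)
  qed
qed

lemma coproduct_transport:
  assumes S: "is_coproduct V I X S \<iota>" and I: "I \<lesssim> U" and X: "\<forall>i \<in> I. X i \<in> Obj V"
  obtains p e where "inj_on p I" "p ` I \<subseteq> U"
    "e \<in> hom V (coprod V (p ` I) (X \<circ> the_inv_into I p)) S" "iso V e"
    "\<And>i. i \<in> I \<Longrightarrow> \<iota> i = e \<cdot> incl V (p ` I) (X \<circ> the_inv_into I p) (p i)"
    "\<And>i. i \<in> I \<Longrightarrow> incl V (p ` I) (X \<circ> the_inv_into I p) (p i)
      \<in> hom V (X i) (coprod V (p ` I) (X \<circ> the_inv_into I p))"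
proof -
  obtain p where p: "inj_on p I" "p ` I \<subseteq> U"
    using I by (auto simp: lepoll_def)
  have "is_coproduct V (p ` I) (X \<circ> the_inv_into I p) (coprod V (p ` I) (X \<circ> the_inv_into I p))
      (incl V (p ` I) (X \<circ> the_inv_into I p))"
    using X by (intro coproduct[OF subset_imp_lepoll[OF p(2)]]) (auto simp: the_inv_into_f_f[OF p(1)])
  note S' = coproduct_reindex[OF p(1) this]
  show thesis
    by (rule coproduct_unique[OF S' S]) (use that p coproduct_incl[OF S'] in force)
qed

lemma coproduct_mono_or_disjoint:
  assumes S: "is_coproduct V I X S \<iota>" and I: "I \<lesssim> U" and ij: "i \<in> I" "j \<in> I"
    and h: "h \<in> hom V W (X i)" and k: "k \<in> hom V W (X j)" and eq: "\<iota> i \<cdot> h = \<iota> j \<cdot> k"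
  shows "if i = j then h = k else is_initial V W"
proof -
  have X: "\<forall>l \<in> I. X l \<in> Obj V"
    using hom_Obj[OF coproduct_incl[OF S]] by blast
  from coproduct_transport[OF S I X]
  obtain p e where p: "inj_on p I" "p ` I \<subseteq> U"
    and e: "e \<in> hom V (coprod V (p ` I) (X \<circ> the_inv_into I p)) S" "iso V e"
    and \<iota>: "\<And>i. i \<in> I \<Longrightarrow> \<iota> i = e \<cdot> incl V (p ` I) (X \<circ> the_inv_into I p) (p i)"
    and incl: "\<And>i. i \<in> I \<Longrightarrow> incl V (p ` I) (X \<circ> the_inv_into I p) (p i)
      \<in> hom V (X i) (coprod V (p ` I) (X \<circ> the_inv_into I p))"
    by blast
  define Q where "Q = X \<circ> the_inv_into I p"
  have Q: "Q (p l) = X l" if "l \<in> I" for l using that by (simp add: Q_def the_inv_into_f_f[OF p(1)])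
  note e = e[folded Q_def] and \<iota> = \<iota>[folded Q_def] and incl = incl[folded Q_def]
  have "incl V (p ` I) Q (p i) \<cdot> h = incl V (p ` I) Q (p j) \<cdot> k"
  proof (rule iso_left_cancel[OF e(2,1) Comp_in[OF h incl[OF ij(1)]] Comp_in[OF k incl[OF ij(2)]]])
    show "e \<cdot> (incl V (p ` I) Q (p i) \<cdot> h) = e \<cdot> (incl V (p ` I) Q (p j) \<cdot> k)"
      using eq h k incl[OF ij(1)] incl[OF ij(2)] e(1) by (simp add: \<iota> ij hom_def)
  qed
  then have "if p i = p j then h = k else is_initial V W"
    using Q X h k ij by (intro chosen_coproduct_mono_or_disjoint[OF p(2), of Q]) auto
  then show ?thesis
    using inj_onD[OF p(1) _ ij] by (auto split: if_splits)
qed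

lemma chosen_coproduct_decompose:
  assumes I: "I \<subseteq> U" and X: "\<forall>i \<in> I. X i \<in> Obj V" and g: "g \<in> hom V Z (coprod V I X)"
  obtains Y \<kappa> f where "is_coproduct V I Y Z \<kappa>" "\<And>i. i \<in> I \<Longrightarrow> f i \<in> hom V (Y i) (X i)"
    "\<And>i. i \<in> I \<Longrightarrow> g \<cdot> \<kappa> i = incl V I X i \<cdot> f i"
proof -
  have eq: "is_equivalence (prod_cat I (\<lambda>i. slice V (X i))) (slice V (coprod V I X)) (slice_coprod V I X)"
    using extensive I X unfolding extensive_def by blast
  have "g \<in> Obj (slice V (coprod V I X))"
    using g by (simp add: slice_def hom_def)
  from equivalence_surj[OF eq this]
  obtain f t where f: "f \<in> Obj (prod_cat I (\<lambda>i. slice V (X i)))"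
    and t: "t \<in> hom (slice V (coprod V I X)) (on_obj (slice_coprod V I X) f) g"
    and t_iso: "iso (slice V (coprod V I X)) t"
    by blast
  define Y where "Y i = Dom V (f i)" for i
  have Y_eq: "Y = (\<lambda>i. Dom V (f i))" by (simp add: fun_eq_iff Y_def)
  have f: "\<forall>i \<in> I. f i \<in> hom V (Y i) (X i)"
    using f by (auto simp: Y_def prod_cat_def slice_def hom_def)
  obtain k where k: "t = (coprod_map V I Y X f, k, g)"
    using t by (auto simp: slice_def hom_def slice_coprod_def Y_eq)
  have small: "I \<lesssim> U" by (rule subset_imp_lepoll[OF I])
  have Y: "is_coproduct V I Y (coprod V I Y) (incl V I Y)"
    using hom_Obj f by (intro coproduct[OF small]) blast
  note sum = coprod_map[OF Y coproduct[OF small X] f]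
  have k_hom: "k \<in> hom V (coprod V I Y) Z" "g \<cdot> k = coprod_map V I Y X f"
    using t sum(1) g by (auto simp: k slice_def hom_def)
  have Z: "is_coproduct V I Y Z (\<lambda>i. k \<cdot> incl V I Y i)"
    by (rule coproduct_iso[OF Y k_hom(1) iso_of_slice_iso[OF t_iso[unfolded k]]])
  have g_incl: "g \<cdot> (k \<cdot> incl V I Y i) = incl V I X i \<cdot> f i" if "i \<in> I" for i
  proof -
    have "g \<cdot> (k \<cdot> incl V I Y i) = (g \<cdot> k) \<cdot> incl V I Y i"
      using g k_hom(1) coproduct_incl[OF Y that] by (simp add: hom_def)
    then show ?thesis using k_hom(2) sum(2)[OF that] by simp
  qed
  show thesis
    by (rule that[OF Z]) (use f g_incl in blast)+
qed

lemma coproduct_decompose: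
  assumes S: "is_coproduct V I X S \<iota>" and I: "I \<lesssim> U" and g: "g \<in> hom V Z S"
  obtains Y \<kappa> f where "is_coproduct V I Y Z \<kappa>" "\<And>i. i \<in> I \<Longrightarrow> f i \<in> hom V (Y i) (X i)"
    "\<And>i. i \<in> I \<Longrightarrow> g \<cdot> \<kappa> i = \<iota> i \<cdot> f i"
proof -
  have X: "\<forall>l \<in> I. X l \<in> Obj V"
    using hom_Obj[OF coproduct_incl[OF S]] by blast
  from coproduct_transport[OF S I X]
  obtain p e where p: "inj_on p I" "p ` I \<subseteq> U"
    and e: "e \<in> hom V (coprod V (p ` I) (X \<circ> the_inv_into I p)) S" "iso V e"
    and \<iota>: "\<And>i. i \<in> I \<Longrightarrow> \<iota> i = e \<cdot> incl V (p ` I) (X \<circ> the_inv_into I p) (p i)"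
    and incl: "\<And>i. i \<in> I \<Longrightarrow> incl V (p ` I) (X \<circ> the_inv_into I p) (p i)
      \<in> hom V (X i) (coprod V (p ` I) (X \<circ> the_inv_into I p))"
    by blast
  define Q where "Q = X \<circ> the_inv_into I p"
  have Q: "Q (p l) = X l" if "l \<in> I" for l using that by (simp add: Q_def the_inv_into_f_f[OF p(1)])
  note e = e[folded Q_def] and \<iota> = \<iota>[folded Q_def] and incl = incl[folded Q_def]
  obtain e' where e': "e' \<in> hom V S (coprod V (p ` I) Q)" "e \<cdot> e' = Ident V S"
    using isoE[OF e(2,1)] by blast
  have "\<forall>j \<in> p ` I. Q j \<in> Obj V" using Q X by simp
  from chosen_coproduct_decompose[OF p(2) this Comp_in[OF g e'(1)]]
  obtain Y \<kappa> f where Y: "is_coproduct V (p ` I) Y Z \<kappa>"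
    and f: "\<And>i. i \<in> I \<Longrightarrow> f (p i) \<in> hom V (Y (p i)) (Q (p i))"
    and g\<kappa>: "\<And>i. i \<in> I \<Longrightarrow> (e' \<cdot> g) \<cdot> \<kappa> (p i) = incl V (p ` I) Q (p i) \<cdot> f (p i)"
    by (metis imageI)
  have "is_coproduct V (p ` I) ((Y \<circ> p) \<circ> the_inv_into I p) = is_coproduct V (p ` I) Y"
    by (auto simp: is_coproduct_def fun_eq_iff the_inv_into_f_f[OF p(1)])
  with Y have Y': "is_coproduct V I (Y \<circ> p) Z (\<kappa> \<circ> p)"
    by (intro coproduct_reindex[OF p(1)]) simp
  have g_incl: "g \<cdot> (\<kappa> \<circ> p) i = \<iota> i \<cdot> f (p i)" if i: "i \<in> I" for i
  proof -
    have \<kappa>: "\<kappa> (p i) \<in> hom V (Y (p i)) Z"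
      using coproduct_incl[OF Y' i] by simp
    have "g \<cdot> \<kappa> (p i) = (e \<cdot> e') \<cdot> (g \<cdot> \<kappa> (p i))"
      using g \<kappa> e'(2) by (simp add: hom_def)
    also have "\<dots> = e \<cdot> ((e' \<cdot> g) \<cdot> \<kappa> (p i))"
      using g \<kappa> e'(1) e(1) by (simp add: hom_def)
    also have "\<dots> = e \<cdot> (incl V (p ` I) Q (p i) \<cdot> f (p i))"
      by (simp only: g\<kappa>[OF i])
    also have "\<dots> = \<iota> i \<cdot> f (p i)"
      using e(1) incl[OF i] f[OF i] by (simp add: \<iota>[OF i] Q[OF i] hom_def)
    finally show ?thesis by simp
  qed
  have f': "f (p i) \<in> hom V ((Y \<circ> p) i) (X i)" if "i \<in> I" for i
    using f[OF that] by (simp add: Q[OF that])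
  show thesis
    by (rule that[OF Y', of "f \<circ> p"]) (use f' g_incl in simp_all)
qed

end


section \<open>Presheaves and their elements\<close>

context cartesian_closed_category
begin

lemma tuple_prj_id: "\<lbrakk>X \<in> Obj V; Y \<in> Obj V\<rbrakk> \<Longrightarrow> tuple V (prj1 V X Y) (prj2 V X Y) = Ident V (prd V X Y)"
  using tuple_prj[of "Ident V (prd V X Y)" "prd V X Y" X Y] by (simp add: hom_def)

lemma iso_bang_iff:
  assumes P: "P \<in> Obj V"
  shows "iso V (bang V P) \<longleftrightarrow> (\<forall>Z \<in> Obj V. \<exists>!u. u \<in> hom V Z P)"
proof
  assume "iso V (bang V P)"
  then obtain p where p: "p \<in> hom V (one V) P" "p \<cdot> bang V P = Ident V P"
    using isoE[OF _ bang_in[OF P]] by blast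
  have u: "u = p \<cdot> bang V Z" if "u \<in> hom V Z P" for u Z
  proof -
    have "u = (p \<cdot> bang V P) \<cdot> u" using that p(2) by (simp add: hom_def)
    then show ?thesis using that p(1) P by (simp add: hom_def)
  qed
  show "\<forall>Z \<in> Obj V. \<exists>!u. u \<in> hom V Z P"
  proof
    fix Z assume "Z \<in> Obj V"
    then have "p \<cdot> bang V Z \<in> hom V Z P" using p(1) bang_in Comp_in by blast
    then show "\<exists>!u. u \<in> hom V Z P" using u by blast
  qed
next
  assume *: "\<forall>Z \<in> Obj V. \<exists>!u. u \<in> hom V Z P"
  then obtain p where p: "p \<in> hom V (one V) P" using one_Obj by blast
  have "p \<cdot> bang V P = Ident V P"
    using * P Comp_in[OF bang_in[OF P] p] Ident_in[OF P] by blast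
  moreover have "bang V P \<cdot> p = Ident V (one V)"
    using to_one_eq Comp_in[OF p bang_in[OF P]] Ident_in[OF one_Obj] by blast
  ultimately show "iso V (bang V P)"
    using isoI[OF bang_in[OF P] p] by blast
qed

text \<open>The hom-object is the pullback of \<open>(s, t)\<close> along \<open>(a, b)\<close>, so its generalized elements at
  stage \<open>Z\<close> are the maps \<open>e\<close> on the right.\<close>

lemma und_hom_terminal_iff:
  assumes pullbacks: "has_pullbacks V"
    and s: "src A \<in> hom V (I1 A) (I0 A)" and t: "tgt A \<in> hom V (I1 A) (I0 A)"
    and a: "a \<in> hom V (one V) (I0 A)" and b: "b \<in> hom V (one V) (I0 A)"
  shows "iso V (bang V (VHom (und V A) a b)) \<longleftrightarrow>
    (\<forall>Z \<in> Obj V. \<exists>!e. e \<in> hom V Z (I1 A) \<and> src A \<cdot> e = a \<cdot> bang V Z \<and> tgt A \<cdot> e = b \<cdot> bang V Z)"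
proof -
  let ?st = "tuple V (src A) (tgt A)" and ?ab = "tuple V a b"
  define P p q where "P = pb V ?st ?ab" and "p = pb1 V ?st ?ab" and "q = pb2 V ?st ?ab"
  have obj: "I0 A \<in> Obj V" "I1 A \<in> Obj V" using hom_Obj[OF s] by simp_all
  have "\<exists>P p q. is_pullback V ?st ?ab P p q"
    using pullbacks s t a b unfolding has_pullbacks_def by (simp add: hom_def)
  then have pb: "is_pullback V ?st ?ab P p q"
    unfolding P_def p_def q_def by (elim exE) (rule chosen_pullback)
  have p: "p \<in> hom V P (I1 A)" and q: "q \<in> hom V P (one V)" and square: "?st \<cdot> p = ?ab \<cdot> q"
    using pb s t a b by (auto simp: is_pullback_def hom_def)
  have P: "P \<in> Obj V" using hom_Obj[OF p] by simp
  have ends: "src A \<cdot> p = a \<cdot> q" "tgt A \<cdot> p = b \<cdot> q"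
  proof -
    have "prj1 V (I0 A) (I0 A) \<cdot> (?st \<cdot> p) = prj1 V (I0 A) (I0 A) \<cdot> (?ab \<cdot> q)"
      "prj2 V (I0 A) (I0 A) \<cdot> (?st \<cdot> p) = prj2 V (I0 A) (I0 A) \<cdot> (?ab \<cdot> q)"
      by (simp_all only: square)
    then show "src A \<cdot> p = a \<cdot> q" "tgt A \<cdot> p = b \<cdot> q"
      using s t a b p q by (simp_all add: hom_def)
  qed
  have universal: "\<exists>!u. u \<in> hom V Z P \<and> p \<cdot> u = e \<and> q \<cdot> u = bang V Z"
    if e: "e \<in> hom V Z (I1 A)" "src A \<cdot> e = a \<cdot> bang V Z" "tgt A \<cdot> e = b \<cdot> bang V Z" for Z e
  proof -
    have Z: "Z \<in> Obj V" using hom_Obj[OF e(1)] by simp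
    have "?st \<cdot> e = ?ab \<cdot> bang V Z"
      using e s t a b Z by (simp add: hom_def)
    moreover have "e \<in> hom V Z (Dom V ?st)" "bang V Z \<in> hom V Z (Dom V ?ab)"
      using e(1) s t a b Z by (simp_all add: hom_def)
    ultimately show ?thesis
      using pb unfolding is_pullback_def by blast
  qed
  have image: "p \<cdot> u \<in> hom V Z (I1 A)" "src A \<cdot> (p \<cdot> u) = a \<cdot> bang V Z" "tgt A \<cdot> (p \<cdot> u) = b \<cdot> bang V Z"
    "q \<cdot> u = bang V Z"
    if u: "u \<in> hom V Z P" for Z u
  proof -
    show pu: "p \<cdot> u \<in> hom V Z (I1 A)" using u p Comp_in by blast
    show qu: "q \<cdot> u = bang V Z"
      using to_one_eq[OF Comp_in[OF u q] bang_in] hom_Obj[OF u] by blast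
    have "src A \<cdot> (p \<cdot> u) = (src A \<cdot> p) \<cdot> u" "tgt A \<cdot> (p \<cdot> u) = (tgt A \<cdot> p) \<cdot> u"
      using s t p u by (simp_all add: hom_def)
    moreover have "(a \<cdot> q) \<cdot> u = a \<cdot> (q \<cdot> u)" "(b \<cdot> q) \<cdot> u = b \<cdot> (q \<cdot> u)"
      using a b q u by (simp_all add: hom_def)
    ultimately show "src A \<cdot> (p \<cdot> u) = a \<cdot> bang V Z" "tgt A \<cdot> (p \<cdot> u) = b \<cdot> bang V Z"
      by (simp_all add: ends qu)
  qed
  have "(\<exists>!u. u \<in> hom V Z P) \<longleftrightarrow>
    (\<exists>!e. e \<in> hom V Z (I1 A) \<and> src A \<cdot> e = a \<cdot> bang V Z \<and> tgt A \<cdot> e = b \<cdot> bang V Z)" for Z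
  proof
    assume *: "\<exists>!u. u \<in> hom V Z P"
    then obtain u where u: "u \<in> hom V Z P" by blast
    show "\<exists>!e. e \<in> hom V Z (I1 A) \<and> src A \<cdot> e = a \<cdot> bang V Z \<and> tgt A \<cdot> e = b \<cdot> bang V Z"
    proof (rule ex1I)
      show "p \<cdot> u \<in> hom V Z (I1 A) \<and> src A \<cdot> (p \<cdot> u) = a \<cdot> bang V Z \<and> tgt A \<cdot> (p \<cdot> u) = b \<cdot> bang V Z"
        using image[OF u] by blast
      fix e assume "e \<in> hom V Z (I1 A) \<and> src A \<cdot> e = a \<cdot> bang V Z \<and> tgt A \<cdot> e = b \<cdot> bang V Z"
      then obtain u' where "u' \<in> hom V Z P" "p \<cdot> u' = e" using universal by blast
      then show "e = p \<cdot> u" using * u by blast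
    qed
  next
    assume *: "\<exists>!e. e \<in> hom V Z (I1 A) \<and> src A \<cdot> e = a \<cdot> bang V Z \<and> tgt A \<cdot> e = b \<cdot> bang V Z"
    then obtain e where e: "e \<in> hom V Z (I1 A)" "src A \<cdot> e = a \<cdot> bang V Z" "tgt A \<cdot> e = b \<cdot> bang V Z"
      by blast
    have "p \<cdot> u = e" if "u \<in> hom V Z P" for u
      using * e image[OF that] by blast
    then show "\<exists>!u. u \<in> hom V Z P"
      using universal[OF e] image(4) by blast
  qed
  moreover have "VHom (und V A) a b = P"
    by (simp add: und_def P_def Let_def)
  ultimately show ?thesis
    using iso_bang_iff[OF P] by simp
qed

end

locale presheaf = cartesian_closed_category V for V :: "('o, 'm) cat" (structure) +
  fixes C :: "('c, 'o, 'm) vcat" and F :: "('c, 'o, 'm) vfun"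
  assumes vcategory: "vcategory V C"
    and vfunctor: "vfunctor V (vop V C) (vself V) F"
begin

text \<open>The action of \<open>C\<close> on \<open>F\<close> at generalized elements.  The axioms of a functor from \<open>vop V C\<close>
  to \<open>vself V\<close> become the laws of an action (\<open>act_VId\<close> and \<open>act_VComp\<close>), and all later
  computations with \<open>F\<close> rest on these two laws.\<close>

abbreviation act :: "'c \<Rightarrow> 'c \<Rightarrow> 'm \<Rightarrow> 'm \<Rightarrow> 'm" where
  "act a b f y \<equiv> ev_psh V C F a b \<cdot> tuple V f y"

lemma VHom_Obj [simp]: "\<lbrakk>a \<in> VObj C; b \<in> VObj C\<rbrakk> \<Longrightarrow> VHom C a b \<in> Obj V"
  using vcategory by (simp add: vcategory_def)

lemma VComp_simps [simp]:
  assumes "a \<in> VObj C" "b \<in> VObj C" "d \<in> VObj C"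
  shows "VComp C a b d \<in> Arr V" "Cod V (VComp C a b d) = VHom C a d"
    and "Dom V (VComp C a b d) = prd V (VHom C a b) (VHom C b d)"
  using vcategory assms by (simp_all add: vcategory_def hom_def)

lemma VId_simps [simp]:
  assumes "a \<in> VObj C"
  shows "VId C a \<in> Arr V" "Dom V (VId C a) = one V" "Cod V (VId C a) = VHom C a a"
  using vcategory assms by (simp_all add: vcategory_def hom_def)

lemma FObj_Obj [simp]: "a \<in> VObj C \<Longrightarrow> FObj F a \<in> Obj V"
  using vfunctor by (simp add: vfunctor_def vop_def vself_def)

lemma FMap_simps [simp]:
  assumes "a \<in> VObj C" "b \<in> VObj C"
  shows "FMap F b a \<in> Arr V" "Dom V (FMap F b a) = VHom C a b"
    and "Cod V (FMap F b a) = ihom V (FObj F b) (FObj F a)"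
  using vfunctor assms by (simp_all add: vfunctor_def vop_def vself_def hom_def)

lemma ev_psh_simps [simp]:
  assumes "a \<in> VObj C" "b \<in> VObj C"
  shows "ev_psh V C F a b \<in> Arr V" "Dom V (ev_psh V C F a b) = prd V (VHom C a b) (FObj F b)"
    and "Cod V (ev_psh V C F a b) = FObj F a"
  using assms by (simp_all add: ev_psh_def)

lemma act_eval:
  assumes "a \<in> VObj C" "b \<in> VObj C" "f \<in> Arr V" "y \<in> Arr V" "Dom V y = Dom V f"
    and "Cod V f = VHom C a b" "Cod V y = FObj F b"
  shows "act a b f y = evl V (FObj F b) (FObj F a) \<cdot> tuple V y (FMap F b a \<cdot> f)"
  using assms by (simp add: ev_psh_def)

lemma evl_vself_Comp:
  assumes "X \<in> Obj V" "Y \<in> Obj V" "Z \<in> Obj V"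
    and "w \<in> Arr V" "h \<in> Arr V" "k \<in> Arr V" "Dom V h = Dom V w" "Dom V k = Dom V w"
    and "Cod V w = X" "Cod V h = ihom V X Y" "Cod V k = ihom V Y Z"
  shows "evl V X Z \<cdot> tuple V w (VComp (vself V) X Y Z \<cdot> tuple V h k)
    = evl V Y Z \<cdot> tuple V (evl V X Y \<cdot> tuple V w h) k"
  using assms by (simp add: vself_def Let_def)

lemma act_VId:
  assumes "a \<in> VObj C" "y \<in> Arr V" "Cod V y = FObj F a"
  shows "act a a (VId C a \<cdot> bang V (Dom V y)) y = y"
proof -
  have law: "FMap F a a \<cdot> VId C a = transp V (FObj F a) (one V) (prj1 V (FObj F a) (one V))"
    using vfunctor assms(1) by (simp add: vfunctor_def vop_def vself_def)
  have "act a a (VId C a \<cdot> bang V (Dom V y)) y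
      = evl V (FObj F a) (FObj F a) \<cdot> tuple V y ((FMap F a a \<cdot> VId C a) \<cdot> bang V (Dom V y))"
    using assms Dom_in[of y] by (simp add: act_eval)
  also have "\<dots> = y"
    using assms Dom_in[of y] by (simp add: law)
  finally show ?thesis .
qed

lemma act_VComp:
  assumes abd: "a \<in> VObj C" "b \<in> VObj C" "d \<in> VObj C"
    and fgy: "f \<in> Arr V" "g \<in> Arr V" "y \<in> Arr V" "Dom V g = Dom V f" "Dom V y = Dom V f"
    and cods: "Cod V f = VHom C a b" "Cod V g = VHom C b d" "Cod V y = FObj F d"
  shows "act a d (VComp C a b d \<cdot> tuple V f g) y = act a b f (act b d g y)"
proof -
  have law: "FMap F d a \<cdot> (VComp C a b d \<cdot> swap V (VHom C b d) (VHom C a b))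
      = VComp (vself V) (FObj F d) (FObj F b) (FObj F a) \<cdot> pmap V (FMap F d b) (FMap F b a)"
    using vfunctor abd by (simp add: vfunctor_def vop_def)
  have vself_Comp: "VComp (vself V) (FObj F d) (FObj F b) (FObj F a) \<in>
      hom V (prd V (ihom V (FObj F d) (FObj F b)) (ihom V (FObj F b) (FObj F a)))
        (ihom V (FObj F d) (FObj F a))"
    using abd by (simp add: vself_def Let_def hom_def)
  have "FMap F d a \<cdot> (VComp C a b d \<cdot> tuple V f g)
      = (FMap F d a \<cdot> (VComp C a b d \<cdot> swap V (VHom C b d) (VHom C a b))) \<cdot> tuple V g f"
    using abd fgy cods by simp
  also have "\<dots> = VComp (vself V) (FObj F d) (FObj F b) (FObj F a)
      \<cdot> tuple V (FMap F d b \<cdot> g) (FMap F b a \<cdot> f)"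
    unfolding law using vself_Comp abd fgy cods by (simp add: hom_def)
  finally have "act a d (VComp C a b d \<cdot> tuple V f g) y = evl V (FObj F b) (FObj F a)
      \<cdot> tuple V (evl V (FObj F d) (FObj F b) \<cdot> tuple V y (FMap F d b \<cdot> g)) (FMap F b a \<cdot> f)"
    using abd fgy cods by (simp add: act_eval evl_vself_Comp)
  also have "\<dots> = act a b f (act b d g y)"
    using abd fgy cods by (simp add: act_eval)
  finally show ?thesis .
qed

lemma VComp_VId:
  assumes "a \<in> VObj C" "b \<in> VObj C" "f \<in> Arr V" "Cod V f = VHom C a b"
  shows "VComp C a b b \<cdot> tuple V f (VId C b \<cdot> bang V (Dom V f)) = f"
proof -
  have law: "VComp C a b b \<cdot> pmap V (Ident V (VHom C a b)) (VId C b) = prj1 V (VHom C a b) (one V)"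
    using vcategory assms(1,2) by (simp add: vcategory_def)
  have "VComp C a b b \<cdot> tuple V f (VId C b \<cdot> bang V (Dom V f))
      = (VComp C a b b \<cdot> pmap V (Ident V (VHom C a b)) (VId C b)) \<cdot> tuple V f (bang V (Dom V f))"
    using assms Dom_in[of f] by simp
  also have "\<dots> = f"
    unfolding law using assms Dom_in[of f] by simp
  finally show ?thesis .
qed

lemma ev_rep_psh:
  assumes "a \<in> VObj C" "b \<in> VObj C" "c \<in> VObj C"
  shows "ev_psh V C (rep_psh V C c) a b = VComp C a b c"
proof -
  let ?p = "prj1 V (VHom C a b) (VHom C b c)" and ?q = "prj2 V (VHom C a b) (VHom C b c)"
  have "ev_psh V C (rep_psh V C c) a b = ev_psh V C (rep_psh V C c) a b \<cdot> tuple V ?p ?q"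
    using assms by (simp add: tuple_prj_id ev_psh_def rep_psh_def)
  also have "\<dots> = VComp C a b c \<cdot> tuple V ?p ?q"
    using assms by (simp add: ev_psh_def rep_psh_def)
  also have "\<dots> = VComp C a b c"
    using assms by (simp add: tuple_prj_id)
  finally show ?thesis .
qed

end

locale presheaf_element = presheaf V C F
  for V :: "('o, 'm) cat" (structure) and C :: "('c, 'o, 'm) vcat" and F :: "('c, 'o, 'm) vfun" +
  fixes c :: 'c and x :: 'm
  assumes c: "c \<in> VObj C" and x: "x \<in> hom V (one V) (FObj F c)"
begin

definition yoneda :: "'c \<Rightarrow> 'm" where
  "yoneda a = act a c (Ident V (VHom C a c)) (x \<cdot> bang V (VHom C a c))"

lemma x_simps [simp]: "x \<in> Arr V" "Dom V x = one V" "Cod V x = FObj F c"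
  using x by (simp_all add: hom_def)

lemma yoneda_in: "a \<in> VObj C \<Longrightarrow> yoneda a \<in> hom V (VHom C a c) (FObj F a)"
  using c by (simp add: yoneda_def hom_def)

lemma yoneda_Comp:
  "\<lbrakk>a \<in> VObj C; f \<in> Arr V; Cod V f = VHom C a c\<rbrakk>
    \<Longrightarrow> yoneda a \<cdot> f = act a c f (x \<cdot> bang V (Dom V f))"
  using c by (simp add: yoneda_def)

text \<open>Naturality at the identity of \<open>c\<close> forces a transformation that corresponds to \<open>x\<close> to be
  \<open>yoneda\<close>; conversely \<open>yoneda\<close> is natural by associativity of the action.\<close>

lemma representable_iff: "representable_by V C F c x \<longleftrightarrow> (\<forall>a \<in> VObj C. iso V (yoneda a))"
proof
  assume "representable_by V C F c x"
  then obtain \<alpha> where \<alpha>: "vnat_psh V C (rep_psh V C c) F \<alpha>" "\<alpha> c \<cdot> VId C c = x"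
    "\<forall>a \<in> VObj C. iso V (\<alpha> a)"
    by (auto simp: representable_by_def)
  have "\<alpha> a = yoneda a" if a: "a \<in> VObj C" for a
  proof -
    let ?i = "Ident V (VHom C a c)" and ?b = "bang V (VHom C a c)"
    have arr: "\<alpha> b \<in> hom V (VHom C b c) (FObj F b)" if "b \<in> VObj C" for b
      using \<alpha>(1) that by (simp add: vnat_psh_def rep_psh_def)
    have nat: "\<alpha> a \<cdot> VComp C a c c = ev_psh V C F a c \<cdot> pmap V ?i (\<alpha> c)"
      using \<alpha>(1) a c unfolding vnat_psh_def ev_rep_psh[OF a c c, symmetric] by blast
    have "\<alpha> a = \<alpha> a \<cdot> (VComp C a c c \<cdot> tuple V ?i (VId C c \<cdot> ?b))"
      using VComp_VId[OF a c, of ?i] arr[OF a] a c by (simp add: hom_def)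
    also have "\<dots> = (\<alpha> a \<cdot> VComp C a c c) \<cdot> tuple V ?i (VId C c \<cdot> ?b)"
      using arr[OF a] a c by (simp add: hom_def)
    also have "\<dots> = act a c ?i ((\<alpha> c \<cdot> VId C c) \<cdot> ?b)"
      unfolding nat using arr[OF a] arr[OF c] a c by (simp add: hom_def)
    finally show ?thesis by (simp add: \<alpha>(2) yoneda_def)
  qed
  then show "\<forall>a \<in> VObj C. iso V (yoneda a)" using \<alpha>(3) by simp
next
  assume iso: "\<forall>a \<in> VObj C. iso V (yoneda a)"
  have "yoneda a \<cdot> ev_psh V C (rep_psh V C c) a b
      = ev_psh V C F a b \<cdot> pmap V (Ident V (VHom C a b)) (yoneda b)"
    if a: "a \<in> VObj C" and b: "b \<in> VObj C" for a b
  proof -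
    let ?p = "prj1 V (VHom C a b) (VHom C b c)" and ?q = "prj2 V (VHom C a b) (VHom C b c)"
    note y = yoneda_in[OF a] yoneda_in[OF b]
    have "yoneda a \<cdot> VComp C a b c = yoneda a \<cdot> (VComp C a b c \<cdot> tuple V ?p ?q)"
      using a b c by (simp add: tuple_prj_id)
    also have "\<dots> = act a b ?p (yoneda b \<cdot> ?q)"
      using a b c by (simp add: yoneda_Comp act_VComp)
    also have "\<dots> = ev_psh V C F a b \<cdot> pmap V (Ident V (VHom C a b)) (yoneda b) \<cdot> tuple V ?p ?q"
      using a b c y by (simp add: hom_def)
    also have "\<dots> = ev_psh V C F a b \<cdot> pmap V (Ident V (VHom C a b)) (yoneda b)"
      using a b c y by (simp add: tuple_prj_id hom_def)
    finally show ?thesis using ev_rep_psh[OF a b c] by simp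
  qed
  then have "vnat_psh V C (rep_psh V C c) F (yoneda)"
    using yoneda_in by (simp add: vnat_psh_def rep_psh_def)
  moreover have "yoneda c \<cdot> VId C c = x"
    using yoneda_Comp[OF c, of "VId C c"] act_VId[OF c, of x] c by simp
  ultimately show "representable_by V C F c x"
    using iso by (auto simp: representable_by_def)
qed

end


section \<open>The category of elements\<close>

lemma times_lepoll_infinite:
  assumes "infinite U" "I \<lesssim> U"
  shows "I \<times> I \<lesssim> U"
proof -
  have "I \<times> I \<lesssim> U \<times> U"
    using assms(2) by (rule times_lepoll_mono[OF _ assms(2)])
  also have "U \<times> U \<approx> U"
    using card_of_Times_same_infinite[OF assms(1)] by (simp add: eqpoll_iff_card_of_ordIso)
  finally show ?thesis .
qed

locale category_of_elements =
  presheaf_element V C F c x + extensive_ccc V U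
  for V :: "('o, 'm) cat" (structure) and C :: "('c, 'o, 'm) vcat" and F :: "('c, 'o, 'm) vfun"
    and c :: 'c and x :: 'm and U :: "'u set" +
  assumes infinite: "infinite U" and small: "VObj C \<lesssim> U" and pullbacks: "has_pullbacks V"
begin

abbreviation Q :: "'c \<times> 'c \<Rightarrow> 'o" where
  "Q \<equiv> \<lambda>(a, b). prd V (VHom C a b) (FObj F b)"

abbreviation \<iota>0 :: "'c \<Rightarrow> 'm" where "\<iota>0 \<equiv> incl V (VObj C) (FObj F)"
abbreviation \<iota>1 :: "'c \<times> 'c \<Rightarrow> 'm" where "\<iota>1 \<equiv> incl V (VObj C \<times> VObj C) Q"
abbreviation E0 :: 'o where "E0 \<equiv> coprod V (VObj C) (FObj F)"
abbreviation E1 :: 'o where "E1 \<equiv> coprod V (VObj C \<times> VObj C) Q"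
abbreviation s :: 'm where "s \<equiv> src (elements V C F)"
abbreviation t :: 'm where "t \<equiv> tgt (elements V C F)"

lemma I0_elements: "I0 (elements V C F) = E0" and I1_elements: "I1 (elements V C F) = E1"
  by (simp_all add: elements_def Let_def)

lemma small_pairs: "VObj C \<times> VObj C \<lesssim> U"
  by (rule times_lepoll_infinite[OF infinite small])

lemma E0: "is_coproduct V (VObj C) (FObj F) E0 \<iota>0"
  by (rule coproduct[OF small]) simp

lemma E1: "is_coproduct V (VObj C \<times> VObj C) Q E1 \<iota>1"
  by (rule coproduct[OF small_pairs]) auto

lemma E_Obj: "E0 \<in> Obj V" "E1 \<in> Obj V"
  using E0 E1 by (simp_all add: is_coproduct_def)

lemma incl_simps [simp]:
  assumes "a \<in> VObj C"
  shows "\<iota>0 a \<in> Arr V" "Dom V (\<iota>0 a) = FObj F a" "Cod V (\<iota>0 a) = E0"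
  using coproduct_incl[OF E0 assms] by (simp_all add: hom_def)

lemma incl1_simps [simp]:
  assumes "a \<in> VObj C" "b \<in> VObj C"
  shows "\<iota>1 (a, b) \<in> Arr V" "Dom V (\<iota>1 (a, b)) = prd V (VHom C a b) (FObj F b)" "Cod V (\<iota>1 (a, b)) = E1"
  using coproduct_incl[OF E1, of "(a, b)"] assms by (simp_all add: hom_def)

lemma src_elements:
  shows s_in: "s \<in> hom V E1 E0"
    and s_incl: "\<lbrakk>a \<in> VObj C; b \<in> VObj C\<rbrakk> \<Longrightarrow> s \<cdot> \<iota>1 (a, b) = \<iota>0 a \<cdot> ev_psh V C F a b"
proof -
  have s: "s = cotuple V (VObj C \<times> VObj C) Q E0 (\<lambda>(a, b). \<iota>0 a \<cdot> ev_psh V C F a b)"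
    by (simp add: elements_def Let_def)
  have "\<forall>i \<in> VObj C \<times> VObj C. (\<lambda>(a, b). \<iota>0 a \<cdot> ev_psh V C F a b) i \<in> hom V (Q i) E0"
    by (auto simp: hom_def)
  note cotuple = cotuple[OF E1 E_Obj(1) this, folded s]
  show "s \<in> hom V E1 E0" by (rule cotuple(1))
  show "\<lbrakk>a \<in> VObj C; b \<in> VObj C\<rbrakk> \<Longrightarrow> s \<cdot> \<iota>1 (a, b) = \<iota>0 a \<cdot> ev_psh V C F a b"
    using cotuple(2)[of "(a, b)"] by simp
qed

lemma tgt_elements:
  shows t_in: "t \<in> hom V E1 E0"
    and t_incl: "\<lbrakk>a \<in> VObj C; b \<in> VObj C\<rbrakk>
      \<Longrightarrow> t \<cdot> \<iota>1 (a, b) = \<iota>0 b \<cdot> prj2 V (VHom C a b) (FObj F b)"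
proof -
  have t: "t = cotuple V (VObj C \<times> VObj C) Q E0 (\<lambda>(a, b). \<iota>0 b \<cdot> prj2 V (VHom C a b) (FObj F b))"
    by (simp add: elements_def Let_def)
  have "\<forall>i \<in> VObj C \<times> VObj C.
      (\<lambda>(a, b). \<iota>0 b \<cdot> prj2 V (VHom C a b) (FObj F b)) i \<in> hom V (Q i) E0"
    by (auto simp: hom_def)
  note cotuple = cotuple[OF E1 E_Obj(1) this, folded t]
  show "t \<in> hom V E1 E0" by (rule cotuple(1))
  show "\<lbrakk>a \<in> VObj C; b \<in> VObj C\<rbrakk> \<Longrightarrow> t \<cdot> \<iota>1 (a, b) = \<iota>0 b \<cdot> prj2 V (VHom C a b) (FObj F b)"
    using cotuple(2)[of "(a, b)"] by simp
qed

lemma st_simps [simp]: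
  "s \<in> Arr V" "Dom V s = E1" "Cod V s = E0" "t \<in> Arr V" "Dom V t = E1" "Cod V t = E0"
  using s_in t_in by (simp_all add: hom_def)

lemma s_incl_Comp:
  assumes "a \<in> VObj C" "b \<in> VObj C" "e \<in> Arr V" "Cod V e = prd V (VHom C a b) (FObj F b)"
  shows "s \<cdot> (\<iota>1 (a, b) \<cdot> e) = \<iota>0 a \<cdot> (ev_psh V C F a b \<cdot> e)"
proof -
  have "s \<cdot> (\<iota>1 (a, b) \<cdot> e) = (s \<cdot> \<iota>1 (a, b)) \<cdot> e" using assms by simp
  then show ?thesis using assms by (simp add: s_incl)
qed

lemma t_incl_Comp:
  assumes "a \<in> VObj C" "b \<in> VObj C" "e \<in> Arr V" "Cod V e = prd V (VHom C a b) (FObj F b)"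
  shows "t \<cdot> (\<iota>1 (a, b) \<cdot> e) = \<iota>0 b \<cdot> (prj2 V (VHom C a b) (FObj F b) \<cdot> e)"
proof -
  have "t \<cdot> (\<iota>1 (a, b) \<cdot> e) = (t \<cdot> \<iota>1 (a, b)) \<cdot> e" using assms by simp
  then show ?thesis using assms by (simp add: t_incl)
qed

lemma incl0_mono_or_disjoint:
  assumes "a \<in> VObj C" "b \<in> VObj C" "h \<in> hom V W (FObj F a)" "k \<in> hom V W (FObj F b)"
    and "\<iota>0 a \<cdot> h = \<iota>0 b \<cdot> k"
  shows "if a = b then h = k else is_initial V W"
  using coproduct_mono_or_disjoint[of "VObj C" "FObj F" E0 \<iota>0 a b h W k, OF E0 small] assms by blast

lemma incl0_mono:
  assumes "a \<in> VObj C" "h \<in> hom V W (FObj F a)" "k \<in> hom V W (FObj F a)" "\<iota>0 a \<cdot> h = \<iota>0 a \<cdot> k"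
  shows "h = k"
  using incl0_mono_or_disjoint[of a a h W k] assms by simp

lemma incl1_mono:
  assumes "a \<in> VObj C" "b \<in> VObj C" "h \<in> hom V W (Q (a, b))" "k \<in> hom V W (Q (a, b))"
    and "\<iota>1 (a, b) \<cdot> h = \<iota>1 (a, b) \<cdot> k"
  shows "h = k"
  using coproduct_mono_or_disjoint[of "VObj C \<times> VObj C" Q E1 \<iota>1 "(a, b)" "(a, b)" h W k, OF E1 small_pairs] assms
  by simp

lemma initial_eq: "\<lbrakk>is_initial V Z; f \<in> hom V Z Y; g \<in> hom V Z Y\<rbrakk> \<Longrightarrow> f = g"
  using hom_Obj[of f Z Y] by (auto simp: is_initial_def)

text \<open>The pieces of \<open>Z\<close> are indexed by the summands \<open>(a', b')\<close> of \<open>E1\<close> that \<open>e\<close> maps them to.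
  Comparing sources forces \<open>a' = a\<close> and comparing targets forces \<open>b' = b\<close>, except on initial
  pieces, where there is nothing to check.\<close>

lemma arrow_over:
  assumes a: "a \<in> VObj C" and b: "b \<in> VObj C"
    and e: "e \<in> hom V Z E1" and z: "z \<in> hom V Z (FObj F a)" and y: "y \<in> hom V Z (FObj F b)"
    and se: "s \<cdot> e = \<iota>0 a \<cdot> z" and te: "t \<cdot> e = \<iota>0 b \<cdot> y"
  shows "\<exists>f \<in> hom V Z (VHom C a b). e = \<iota>1 (a, b) \<cdot> tuple V f y \<and> act a b f y = z"
proof -
  obtain Y \<kappa> g where Z: "is_coproduct V (VObj C \<times> VObj C) Y Z \<kappa>"
    and g: "\<And>i. i \<in> VObj C \<times> VObj C \<Longrightarrow> g i \<in> hom V (Y i) (Q i)"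
    and e\<kappa>: "\<And>i. i \<in> VObj C \<times> VObj C \<Longrightarrow> e \<cdot> \<kappa> i = \<iota>1 i \<cdot> g i"
    using coproduct_decompose[OF E1 small_pairs e] by blast
  note \<kappa> = coproduct_incl[OF Z]
  have s_part: "\<iota>0 a' \<cdot> (ev_psh V C F a' b' \<cdot> g (a', b')) = \<iota>0 a \<cdot> (z \<cdot> \<kappa> (a', b'))"
    and t_part: "\<iota>0 b' \<cdot> (prj2 V (VHom C a' b') (FObj F b') \<cdot> g (a', b')) = \<iota>0 b \<cdot> (y \<cdot> \<kappa> (a', b'))"
    if a': "a' \<in> VObj C" and b': "b' \<in> VObj C" for a' b'
  proof -
    have i: "(a', b') \<in> VObj C \<times> VObj C" using a' b' by simp
    note g' = g[OF i] and \<kappa>' = \<kappa>[OF i]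
    have "\<iota>0 a' \<cdot> (ev_psh V C F a' b' \<cdot> g (a', b')) = s \<cdot> (e \<cdot> \<kappa> (a', b'))"
      using s_incl_Comp[OF a' b', of "g (a', b')"] g' e\<kappa>[OF i] by (simp add: hom_def)
    also have "\<dots> = (s \<cdot> e) \<cdot> \<kappa> (a', b')"
      using e \<kappa>' by (simp add: hom_def)
    also have "\<dots> = \<iota>0 a \<cdot> (z \<cdot> \<kappa> (a', b'))"
      unfolding se using z \<kappa>' a by (simp add: hom_def)
    finally show "\<iota>0 a' \<cdot> (ev_psh V C F a' b' \<cdot> g (a', b')) = \<iota>0 a \<cdot> (z \<cdot> \<kappa> (a', b'))" .
    have "\<iota>0 b' \<cdot> (prj2 V (VHom C a' b') (FObj F b') \<cdot> g (a', b')) = t \<cdot> (e \<cdot> \<kappa> (a', b'))"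
      using t_incl_Comp[OF a' b', of "g (a', b')"] g' e\<kappa>[OF i] by (simp add: hom_def)
    also have "\<dots> = (t \<cdot> e) \<cdot> \<kappa> (a', b')"
      using e \<kappa>' by (simp add: hom_def)
    also have "\<dots> = \<iota>0 b \<cdot> (y \<cdot> \<kappa> (a', b'))"
      unfolding te using y \<kappa>' b by (simp add: hom_def)
    finally show "\<iota>0 b' \<cdot> (prj2 V (VHom C a' b') (FObj F b') \<cdot> g (a', b')) = \<iota>0 b \<cdot> (y \<cdot> \<kappa> (a', b'))" .
  qed
  have initial: "is_initial V (Y i)" if i: "i \<in> VObj C \<times> VObj C" "i \<noteq> (a, b)" for i
  proof -
    obtain a' b' where i': "i = (a', b')" "a' \<in> VObj C" "b' \<in> VObj C" using i(1) by auto
    have \<kappa>': "\<kappa> (a', b') \<in> hom V (Y (a', b')) Z" and g': "g (a', b') \<in> hom V (Y (a', b')) (Q (a', b'))"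
      using \<kappa>[OF i(1)] g[OF i(1)] i'(1) by simp_all
    have "ev_psh V C F a' b' \<cdot> g (a', b') \<in> hom V (Y (a', b')) (FObj F a')"
      "prj2 V (VHom C a' b') (FObj F b') \<cdot> g (a', b') \<in> hom V (Y (a', b')) (FObj F b')"
      "z \<cdot> \<kappa> (a', b') \<in> hom V (Y (a', b')) (FObj F a)" "y \<cdot> \<kappa> (a', b') \<in> hom V (Y (a', b')) (FObj F b)"
      using g' \<kappa>' i' z y by (simp_all add: hom_def)
    from incl0_mono_or_disjoint[OF i'(2) a this(1,3) s_part] incl0_mono_or_disjoint[OF i'(3) b this(2,4) t_part]
    show ?thesis using i' i(2) by (auto split: if_splits)
  qed
  have ab: "(a, b) \<in> VObj C \<times> VObj C" using a b by simp
  \<comment> \<open>The map \<open>f\<close> is glued from its pieces; on the initial ones it is the unique map.\<close>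
  define f' where "f' i = (if i = (a, b) then prj1 V (VHom C a b) (FObj F b) \<cdot> g (a, b)
    else (THE h. h \<in> hom V (Y i) (VHom C a b)))" for i
  have f': "\<forall>i \<in> VObj C \<times> VObj C. f' i \<in> hom V (Y i) (VHom C a b)"
  proof
    fix i assume i: "i \<in> VObj C \<times> VObj C"
    show "f' i \<in> hom V (Y i) (VHom C a b)"
    proof (cases "i = (a, b)")
      case True
      then show ?thesis using g[OF ab] a b by (simp add: f'_def hom_def)
    next
      case False
      then show ?thesis
        using theI'[of "\<lambda>h. h \<in> hom V (Y i) (VHom C a b)"] initial[OF i False] VHom_Obj[OF a b]
        by (simp add: f'_def is_initial_def)
    qed
  qed
  obtain f where f: "f \<in> hom V Z (VHom C a b)"
    and f\<kappa>: "\<And>i. i \<in> VObj C \<times> VObj C \<Longrightarrow> f \<cdot> \<kappa> i = f' i"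
    using coproduct_induced[OF Z VHom_Obj[OF a b] f'] by blast
  have fy: "tuple V f y \<in> hom V Z (Q (a, b))" using f y by (simp add: hom_def)
  have rhs: "\<iota>1 (a, b) \<cdot> tuple V f y \<in> hom V Z E1" using fy a b by (simp add: hom_def)
  have e_eq: "e = \<iota>1 (a, b) \<cdot> tuple V f y"
  proof (rule coproduct_eqI[OF Z e rhs])
    fix i assume i: "i \<in> VObj C \<times> VObj C"
    show "e \<cdot> \<kappa> i = (\<iota>1 (a, b) \<cdot> tuple V f y) \<cdot> \<kappa> i"
    proof (cases "i = (a, b)")
      case False
      show ?thesis
        by (rule initial_eq[OF initial[OF i False] Comp_in[OF \<kappa>[OF i] e] Comp_in[OF \<kappa>[OF i] rhs]])
    next
      case True
      have \<kappa>': "\<kappa> (a, b) \<in> hom V (Y (a, b)) Z" and g': "g (a, b) \<in> hom V (Y (a, b)) (Q (a, b))"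
        using \<kappa>[OF ab] g[OF ab] .
      have "prj2 V (VHom C a b) (FObj F b) \<cdot> g (a, b) = y \<cdot> \<kappa> (a, b)"
        by (rule incl0_mono[OF b _ _ t_part[OF a b]]) (use g' \<kappa>' y a b in \<open>simp_all add: hom_def\<close>)
      moreover have "f \<cdot> \<kappa> (a, b) = prj1 V (VHom C a b) (FObj F b) \<cdot> g (a, b)"
        using f\<kappa>[OF ab] by (simp add: f'_def)
      moreover have "g (a, b) = tuple V (prj1 V (VHom C a b) (FObj F b) \<cdot> g (a, b))
          (prj2 V (VHom C a b) (FObj F b) \<cdot> g (a, b))"
        using g' a b by (intro tuple_prj) simp_all
      ultimately have "g (a, b) = tuple V f y \<cdot> \<kappa> (a, b)"
        using f y \<kappa>' by (simp add: hom_def)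
      then show ?thesis
        using e\<kappa>[OF ab] True fy \<kappa>' a b f y by (simp add: hom_def)
    qed
  qed
  moreover have "act a b f y = z"
  proof (rule incl0_mono[OF a _ z])
    show "act a b f y \<in> hom V Z (FObj F a)" using f y a b by (simp add: hom_def)
    show "\<iota>0 a \<cdot> act a b f y = \<iota>0 a \<cdot> z"
      using se[unfolded e_eq] s_incl_Comp[OF a b, of "tuple V f y"] f y by (simp add: hom_def)
  qed
  ultimately show ?thesis using f by blast
qed

text \<open>Together with \<open>arrow_of_hom\<close>: the arrows into \<open>(c, x)\<close> from an element \<open>z\<close> of \<open>F a\<close> at stage
  \<open>Z\<close> are the lifts of \<open>z\<close> along \<open>yoneda a\<close>.\<close>

lemma arrow_to_element:
  assumes a: "a \<in> VObj C" and e: "e \<in> hom V Z E1" and z: "z \<in> hom V Z (FObj F a)"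
    and se: "s \<cdot> e = \<iota>0 a \<cdot> z" and te: "t \<cdot> e = element V C F c x \<cdot> bang V Z"
  shows "\<exists>f \<in> hom V Z (VHom C a c). e = \<iota>1 (a, c) \<cdot> tuple V f (x \<cdot> bang V Z) \<and> yoneda a \<cdot> f = z"
proof -
  have Z: "Z \<in> Obj V" using hom_Obj[OF e] by simp
  have y: "x \<cdot> bang V Z \<in> hom V Z (FObj F c)" using Z by (simp add: hom_def)
  have te': "t \<cdot> e = \<iota>0 c \<cdot> (x \<cdot> bang V Z)"
    using te Z c by (simp add: element_def)
  obtain f where f: "f \<in> hom V Z (VHom C a c)" "e = \<iota>1 (a, c) \<cdot> tuple V f (x \<cdot> bang V Z)"
      "act a c f (x \<cdot> bang V Z) = z"
    using arrow_over[OF a c e z y se te'] by blast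
  then show ?thesis using yoneda_Comp[OF a, of f] by (auto simp: hom_def)
qed

lemma arrow_of_hom:
  assumes a: "a \<in> VObj C" and f: "f \<in> hom V Z (VHom C a c)"
  shows "\<iota>1 (a, c) \<cdot> tuple V f (x \<cdot> bang V Z) \<in> hom V Z E1"
    and "s \<cdot> (\<iota>1 (a, c) \<cdot> tuple V f (x \<cdot> bang V Z)) = \<iota>0 a \<cdot> (yoneda a \<cdot> f)"
    and "t \<cdot> (\<iota>1 (a, c) \<cdot> tuple V f (x \<cdot> bang V Z)) = element V C F c x \<cdot> bang V Z"
proof -
  have Z: "Z \<in> Obj V" using hom_Obj[OF f] by simp
  show "\<iota>1 (a, c) \<cdot> tuple V f (x \<cdot> bang V Z) \<in> hom V Z E1"
    using a c f Z by (simp add: hom_def)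
  show "s \<cdot> (\<iota>1 (a, c) \<cdot> tuple V f (x \<cdot> bang V Z)) = \<iota>0 a \<cdot> (yoneda a \<cdot> f)"
    using a c f Z by (simp add: hom_def s_incl_Comp yoneda_Comp)
  show "t \<cdot> (\<iota>1 (a, c) \<cdot> tuple V f (x \<cdot> bang V Z)) = element V C F c x \<cdot> bang V Z"
    using a c f Z by (simp add: hom_def t_incl_Comp element_def)
qed

lemma element_in: "element V C F c x \<in> hom V (one V) E0"
  using c by (simp add: element_def hom_def)

lemma vterminal_iff:
  "vterminal V (und V (elements V C F)) (element V C F c x) \<longleftrightarrow>
    (\<forall>g \<in> hom V (one V) E0. \<forall>Z \<in> Obj V. \<exists>!e. e \<in> hom V Z E1 \<and>
      s \<cdot> e = g \<cdot> bang V Z \<and> t \<cdot> e = element V C F c x \<cdot> bang V Z)"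
proof -
  have objects: "VObj (und V (elements V C F)) = hom V (one V) E0"
    by (simp add: und_def Let_def I0_elements)
  have "iso V (bang V (VHom (und V (elements V C F)) g (element V C F c x))) \<longleftrightarrow>
    (\<forall>Z \<in> Obj V. \<exists>!e. e \<in> hom V Z E1 \<and>
      s \<cdot> e = g \<cdot> bang V Z \<and> t \<cdot> e = element V C F c x \<cdot> bang V Z)"
    if "g \<in> hom V (one V) E0" for g
    using und_hom_terminal_iff[of "elements V C F" g "element V C F c x"] pullbacks s_in t_in that element_in
    by (simp add: I0_elements I1_elements)
  then show ?thesis
    using element_in by (simp add: vterminal_def objects)
qed

text \<open>The stage \<open>Z\<close> is cut into pieces along the constant map at \<open>g\<close>.  On each piece the source is
  an element of a single \<open>F a\<close>, and the required arrow is its lift along the isomorphism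
  \<open>yoneda a\<close>.\<close>

lemma vterminal_if_yoneda_iso:
  assumes iso: "\<forall>a \<in> VObj C. iso V (yoneda a)"
  shows "vterminal V (und V (elements V C F)) (element V C F c x)"
  unfolding vterminal_iff
proof (intro ballI)
  fix g Z assume g: "g \<in> hom V (one V) E0" and Z: "Z \<in> Obj V"
  have gZ: "g \<cdot> bang V Z \<in> hom V Z E0" using Comp_in[OF bang_in[OF Z] g] .
  obtain Y \<kappa> z where Zc: "is_coproduct V (VObj C) Y Z \<kappa>"
    and z: "\<And>a. a \<in> VObj C \<Longrightarrow> z a \<in> hom V (Y a) (FObj F a)"
    and gz: "\<And>a. a \<in> VObj C \<Longrightarrow> (g \<cdot> bang V Z) \<cdot> \<kappa> a = \<iota>0 a \<cdot> z a"
    using coproduct_decompose[OF E0 small gZ] by blast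
  note \<kappa> = coproduct_incl[OF Zc]
  have "\<exists>f. f \<in> hom V (Y a) (VHom C a c) \<and> yoneda a \<cdot> f = z a" if a: "a \<in> VObj C" for a
  proof -
    obtain k where k: "k \<in> hom V (FObj F a) (VHom C a c)" "yoneda a \<cdot> k = Ident V (FObj F a)"
      using isoE[OF iso[rule_format, OF a] yoneda_in[OF a]] by blast
    have "yoneda a \<cdot> (k \<cdot> z a) = (yoneda a \<cdot> k) \<cdot> z a"
      using yoneda_in[OF a] k(1) z[OF a] by (simp add: hom_def)
    then have "yoneda a \<cdot> (k \<cdot> z a) = z a"
      using z[OF a] by (simp add: k(2) hom_def)
    then show ?thesis using Comp_in[OF z[OF a] k(1)] by blast
  qed
  then obtain f where f: "\<And>a. a \<in> VObj C \<Longrightarrow> f a \<in> hom V (Y a) (VHom C a c)"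
    and yf: "\<And>a. a \<in> VObj C \<Longrightarrow> yoneda a \<cdot> f a = z a"
    by metis
  let ?e = "\<lambda>a. \<iota>1 (a, c) \<cdot> tuple V (f a) (x \<cdot> bang V (Y a))"
  have "\<forall>a \<in> VObj C. ?e a \<in> hom V (Y a) E1" using arrow_of_hom(1) f by blast
  then obtain e where e: "e \<in> hom V Z E1" and e\<kappa>: "\<And>a. a \<in> VObj C \<Longrightarrow> e \<cdot> \<kappa> a = ?e a"
    using coproduct_induced[OF Zc E_Obj(2), of ?e] by blast
  have bang_\<kappa>: "bang V Z \<cdot> \<kappa> a = bang V (Y a)" if "a \<in> VObj C" for a
    using \<kappa>[OF that] by (simp add: hom_def)
  have TZ: "element V C F c x \<cdot> bang V Z \<in> hom V Z E0" using Comp_in[OF bang_in[OF Z] element_in] .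
  have T\<kappa>: "(element V C F c x \<cdot> bang V Z) \<cdot> \<kappa> a = element V C F c x \<cdot> bang V (Y a)"
    if "a \<in> VObj C" for a
    using \<kappa>[OF that] bang_\<kappa>[OF that] element_in Z by (simp add: hom_def)
  show "\<exists>!e. e \<in> hom V Z E1 \<and> s \<cdot> e = g \<cdot> bang V Z \<and> t \<cdot> e = element V C F c x \<cdot> bang V Z"
  proof (rule ex1I)
    have "s \<cdot> e = g \<cdot> bang V Z"
    proof (rule coproduct_eqI[OF Zc Comp_in[OF e s_in] gZ])
      fix a assume a: "a \<in> VObj C"
      have "(s \<cdot> e) \<cdot> \<kappa> a = s \<cdot> (e \<cdot> \<kappa> a)" using e \<kappa>[OF a] by (simp add: hom_def)
      then show "(s \<cdot> e) \<cdot> \<kappa> a = (g \<cdot> bang V Z) \<cdot> \<kappa> a"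
        using arrow_of_hom(2)[OF a f[OF a]] by (simp only: e\<kappa>[OF a] yf[OF a] gz[OF a])
    qed
    moreover have "t \<cdot> e = element V C F c x \<cdot> bang V Z"
    proof (rule coproduct_eqI[OF Zc Comp_in[OF e t_in] TZ])
      fix a assume a: "a \<in> VObj C"
      have "(t \<cdot> e) \<cdot> \<kappa> a = t \<cdot> (e \<cdot> \<kappa> a)" using e \<kappa>[OF a] by (simp add: hom_def)
      then show "(t \<cdot> e) \<cdot> \<kappa> a = (element V C F c x \<cdot> bang V Z) \<cdot> \<kappa> a"
        using arrow_of_hom(3)[OF a f[OF a]] by (simp only: e\<kappa>[OF a] T\<kappa>[OF a])
    qed
    ultimately show "e \<in> hom V Z E1 \<and> s \<cdot> e = g \<cdot> bang V Z \<and> t \<cdot> e = element V C F c x \<cdot> bang V Z"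
      using e by blast
  next
    fix e' assume e': "e' \<in> hom V Z E1 \<and> s \<cdot> e' = g \<cdot> bang V Z \<and> t \<cdot> e' = element V C F c x \<cdot> bang V Z"
    show "e' = e"
    proof (rule coproduct_eqI[OF Zc _ e])
      show "e' \<in> hom V Z E1" using e' by blast
      fix a assume a: "a \<in> VObj C"
      have "s \<cdot> (e' \<cdot> \<kappa> a) = (s \<cdot> e') \<cdot> \<kappa> a" "t \<cdot> (e' \<cdot> \<kappa> a) = (t \<cdot> e') \<cdot> \<kappa> a"
        using e'[THEN conjunct1] \<kappa>[OF a] by (simp_all add: hom_def)
      then have "s \<cdot> (e' \<cdot> \<kappa> a) = \<iota>0 a \<cdot> z a" "t \<cdot> (e' \<cdot> \<kappa> a) = element V C F c x \<cdot> bang V (Y a)"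
        using e' gz[OF a] T\<kappa>[OF a] by simp_all
      then obtain f' where f': "f' \<in> hom V (Y a) (VHom C a c)"
        "e' \<cdot> \<kappa> a = \<iota>1 (a, c) \<cdot> tuple V f' (x \<cdot> bang V (Y a))" "yoneda a \<cdot> f' = z a"
        using arrow_to_element[OF a Comp_in[OF \<kappa>[OF a]] z[OF a]] e' by blast
      have "f' = f a"
        using iso_left_cancel[OF iso[rule_format, OF a] yoneda_in[OF a] f'(1) f[OF a]] f'(3) yf[OF a] by simp
      then show "e' \<cdot> \<kappa> a = e \<cdot> \<kappa> a" using f'(2) e\<kappa>[OF a] by simp
    qed
  qed
qed

text \<open>Terminality at the terminal stage and for sources in the summand \<open>F a\<close>: unique arrows are
  unique lifts.\<close>

lemma yoneda_bij_on_elements: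
  assumes terminal: "vterminal V (und V (elements V C F)) (element V C F c x)" and a: "a \<in> VObj C"
  shows "bij_betw (\<lambda>f. yoneda a \<cdot> f) (hom V (one V) (VHom C a c)) (hom V (one V) (FObj F a))"
proof -
  have unique: "\<exists>!e. e \<in> hom V (one V) E1 \<and> s \<cdot> e = \<iota>0 a \<cdot> z \<and>
      t \<cdot> e = element V C F c x \<cdot> bang V (one V)"
    if z: "z \<in> hom V (one V) (FObj F a)" for z
  proof -
    have "\<iota>0 a \<cdot> z \<in> hom V (one V) E0" using z a by (simp add: hom_def)
    then have "\<exists>!e. e \<in> hom V (one V) E1 \<and> s \<cdot> e = (\<iota>0 a \<cdot> z) \<cdot> bang V (one V) \<and>
      t \<cdot> e = element V C F c x \<cdot> bang V (one V)"
      using terminal one_Obj unfolding vterminal_iff by blast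
    moreover have "(\<iota>0 a \<cdot> z) \<cdot> bang V (one V) = \<iota>0 a \<cdot> z" using z a by (simp add: hom_def)
    ultimately show ?thesis by simp
  qed
  show ?thesis
  proof (rule bij_betwI')
    fix f f' assume f: "f \<in> hom V (one V) (VHom C a c)" and f': "f' \<in> hom V (one V) (VHom C a c)"
    have tuples: "tuple V h (x \<cdot> bang V (one V)) \<in> hom V (one V) (Q (a, c))"
      if "h \<in> hom V (one V) (VHom C a c)" for h
      using that by (simp add: hom_def)
    have "f = f'" if eq: "yoneda a \<cdot> f = yoneda a \<cdot> f'"
    proof -
      have "\<iota>1 (a, c) \<cdot> tuple V f (x \<cdot> bang V (one V)) = \<iota>1 (a, c) \<cdot> tuple V f' (x \<cdot> bang V (one V))"
        (is "?e f = ?e f'")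
      proof -
        have "?e f' \<in> hom V (one V) E1 \<and> s \<cdot> ?e f' = \<iota>0 a \<cdot> (yoneda a \<cdot> f) \<and>
            t \<cdot> ?e f' = element V C F c x \<cdot> bang V (one V)"
          unfolding eq using arrow_of_hom[OF a f'] by blast
        then show ?thesis
          using unique[OF Comp_in[OF f yoneda_in[OF a]]] arrow_of_hom[OF a f] by blast
      qed
      then have "tuple V f (x \<cdot> bang V (one V)) = tuple V f' (x \<cdot> bang V (one V))"
        by (rule incl1_mono[OF a c tuples[OF f] tuples[OF f']])
      moreover have "prj1 V (VHom C a c) (FObj F c) \<cdot> tuple V h (x \<cdot> bang V (one V)) = h"
        if "h \<in> hom V (one V) (VHom C a c)" for h
        using that by (simp add: hom_def)
      ultimately show ?thesis using f f' by metis
    qed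
    then show "(yoneda a \<cdot> f = yoneda a \<cdot> f') = (f = f')" by blast
  next
    fix f assume "f \<in> hom V (one V) (VHom C a c)"
    then show "yoneda a \<cdot> f \<in> hom V (one V) (FObj F a)" using Comp_in yoneda_in[OF a] by blast
  next
    fix z assume z: "z \<in> hom V (one V) (FObj F a)"
    obtain e where "e \<in> hom V (one V) E1" "s \<cdot> e = \<iota>0 a \<cdot> z"
        "t \<cdot> e = element V C F c x \<cdot> bang V (one V)"
      using unique[OF z] by blast
    then show "\<exists>f \<in> hom V (one V) (VHom C a c). z = yoneda a \<cdot> f"
      using arrow_to_element[OF a _ z] by blast
  qed
qed

end


section \<open>Tensors reduce generalized elements to global ones\<close>

context presheaf_element
begin

text \<open>Every map \<open>k\<close> out of \<open>X\<close> is composition of \<open>\<gamma>\<close> with a global element: apply the inverse of the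
  isomorphism that defines the tensor to the name of \<open>k\<close>.\<close>

lemma tensor_hom:
  assumes X: "X \<in> Obj V" and a: "a \<in> VObj C" and b: "b \<in> VObj C"
    and T: "is_tensor V C X a T \<gamma>" and k: "k \<in> hom V X (VHom C a b)"
  shows "\<exists>g \<in> hom V (one V) (VHom C T b). VComp C a T b \<cdot> tuple V \<gamma> (g \<cdot> bang V X) = k"
proof -
  have T': "T \<in> VObj C" and \<gamma>: "\<gamma> \<in> hom V X (VHom C a T)"
    using T by (simp_all add: is_tensor_def)
  let ?w = "VComp C a T b \<cdot> pmap V \<gamma> (Ident V (VHom C T b))"
  let ?\<tau> = "transp V X (VHom C T b) ?w"
  have iso: "iso V ?\<tau>" using T b by (simp add: is_tensor_def)
  have w: "?w \<in> hom V (prd V X (VHom C T b)) (VHom C a b)"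
    using \<gamma> a b T' by (simp add: hom_def)
  have \<tau>: "?\<tau> \<in> hom V (VHom C T b) (ihom V X (VHom C a b))"
    using transp_simps[of ?w X "VHom C T b"] w X b T' by (simp add: hom_def)
  obtain v where v: "v \<in> hom V (one V) (ihom V X (VHom C a b))"
    "evl V X (VHom C a b) \<cdot> tuple V (Ident V X) (v \<cdot> bang V X) = k"
    using name_of_map[OF k] by blast
  obtain r where r: "r \<in> hom V (ihom V X (VHom C a b)) (VHom C T b)"
    "?\<tau> \<cdot> r = Ident V (ihom V X (VHom C a b))"
    using isoE[OF iso \<tau>] by blast
  have g: "r \<cdot> v \<in> hom V (one V) (VHom C T b)" using Comp_in[OF v(1) r(1)] .
  have "k = evl V X (VHom C a b) \<cdot> tuple V (Ident V X) (((?\<tau> \<cdot> r) \<cdot> v) \<cdot> bang V X)"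
    using v by (simp add: r(2) hom_def)
  also have "\<dots> = evl V X (VHom C a b) \<cdot> tuple V (Ident V X) (?\<tau> \<cdot> ((r \<cdot> v) \<cdot> bang V X))"
    using v(1) r(1) \<tau> X by (simp add: hom_def)
  also have "\<dots> = ?w \<cdot> tuple V (Ident V X) ((r \<cdot> v) \<cdot> bang V X)"
    using w g X T' b by (intro evl_tuple_transp) (auto simp: hom_def)
  also have "\<dots> = VComp C a T b \<cdot> tuple V \<gamma> ((r \<cdot> v) \<cdot> bang V X)"
    using g X T' a b \<gamma> by (simp add: hom_def)
  finally show ?thesis using g by metis
qed

text \<open>The counterpart for \<open>F\<close>: by the isomorphism \<open>[X, F a] \<cong> F T\<close>, maps from \<open>X\<close> to \<open>F a\<close>
  correspond to global elements of \<open>F T\<close>, and the compatibility of that isomorphism with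
  evaluation makes the correspondence the action of \<open>\<gamma>\<close>.\<close>

lemma tensor_elements:
  assumes X: "X \<in> Obj V" and a: "a \<in> VObj C"
    and T: "is_tensor V C X a T \<gamma>" and preserves: "preserves_tensors V C F X"
    and h: "h \<in> hom V X (FObj F a)"
  shows "\<exists>!w. w \<in> hom V (one V) (FObj F T) \<and> act a T \<gamma> (w \<cdot> bang V X) = h"
proof -
  have T': "T \<in> VObj C" and \<gamma>: "\<gamma> \<in> hom V X (VHom C a T)"
    using T by (simp_all add: is_tensor_def)
  obtain \<phi> where \<phi>: "\<phi> \<in> hom V (ihom V X (FObj F a)) (FObj F T)" "iso V \<phi>"
    "ev_psh V C F a T \<cdot> pmap V \<gamma> \<phi> = evl V X (FObj F a)"
    using preserves a T unfolding preserves_tensors_def by blast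
  obtain r where r: "r \<in> hom V (FObj F T) (ihom V X (FObj F a))" "\<phi> \<cdot> r = Ident V (FObj F T)"
    using isoE[OF \<phi>(2,1)] by blast
  have act_\<phi>: "act a T \<gamma> ((\<phi> \<cdot> v) \<cdot> bang V X)
      = evl V X (FObj F a) \<cdot> tuple V (Ident V X) (v \<cdot> bang V X)"
    if v: "v \<in> hom V (one V) (ihom V X (FObj F a))" for v
  proof -
    have "act a T \<gamma> ((\<phi> \<cdot> v) \<cdot> bang V X)
        = (ev_psh V C F a T \<cdot> pmap V \<gamma> \<phi>) \<cdot> tuple V (Ident V X) (v \<cdot> bang V X)"
      using v \<phi>(1) \<gamma> X a T' by (simp add: hom_def)
    then show ?thesis by (simp only: \<phi>(3))
  qed
  show ?thesis
  proof (rule ex_ex1I)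
    obtain v where v: "v \<in> hom V (one V) (ihom V X (FObj F a))"
      "evl V X (FObj F a) \<cdot> tuple V (Ident V X) (v \<cdot> bang V X) = h"
      using name_of_map[OF h] by blast
    then show "\<exists>w. w \<in> hom V (one V) (FObj F T) \<and> act a T \<gamma> (w \<cdot> bang V X) = h"
      using act_\<phi>[OF v(1)] Comp_in[OF v(1) \<phi>(1)] by blast
  next
    fix w w'
    assume w: "w \<in> hom V (one V) (FObj F T) \<and> act a T \<gamma> (w \<cdot> bang V X) = h"
      and w': "w' \<in> hom V (one V) (FObj F T) \<and> act a T \<gamma> (w' \<cdot> bang V X) = h"
    have \<phi>r: "\<phi> \<cdot> (r \<cdot> u) = u" if "u \<in> hom V (one V) (FObj F T)" for u
    proof -
      have "\<phi> \<cdot> (r \<cdot> u) = (\<phi> \<cdot> r) \<cdot> u" using that \<phi>(1) r(1) by (simp add: hom_def)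
      then show ?thesis using that by (simp add: r(2) hom_def)
    qed
    have ru: "r \<cdot> u \<in> hom V (one V) (ihom V X (FObj F a))" if "u \<in> hom V (one V) (FObj F T)" for u
      using Comp_in[OF that r(1)] .
    have "r \<cdot> w = r \<cdot> w'"
      using w w' act_\<phi>[OF ru] \<phi>r a
      by (intro element_of_ihom_eqI[OF ru ru X FObj_Obj[OF a]]) auto
    then show "w = w'" using \<phi>r w w' by metis
  qed
qed

text \<open>By associativity of the action, \<open>yoneda a\<close> sends the map that corresponds to a global element
  \<open>g\<close> of \<open>C(T, c)\<close> to the map that corresponds to \<open>yoneda T \<cdot> g\<close>; so bijectivity of
  \<open>yoneda T\<close> on global elements carries over to \<open>yoneda a\<close> on maps out of \<open>X\<close>.\<close>

lemma yoneda_bij_on_tensor_elements: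
  assumes X: "X \<in> Obj V" and tensors: "has_tensors V C X" and preserves: "preserves_tensors V C F X"
    and bij: "\<And>b. b \<in> VObj C \<Longrightarrow>
      bij_betw (\<lambda>f. yoneda b \<cdot> f) (hom V (one V) (VHom C b c)) (hom V (one V) (FObj F b))"
    and a: "a \<in> VObj C"
  shows "bij_betw (\<lambda>k. yoneda a \<cdot> k) (hom V X (VHom C a c)) (hom V X (FObj F a))"
proof -
  obtain T \<gamma> where T: "is_tensor V C X a T \<gamma>"
    using tensors a unfolding has_tensors_def by blast
  have T': "T \<in> VObj C" and \<gamma>: "\<gamma> \<in> hom V X (VHom C a T)"
    using T by (simp_all add: is_tensor_def)
  define cmp where "cmp g = VComp C a T c \<cdot> tuple V \<gamma> (g \<cdot> bang V X)" for g
  have cmp: "cmp g \<in> hom V X (VHom C a c)"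
    and yoneda_cmp: "yoneda a \<cdot> cmp g = act a T \<gamma> ((yoneda T \<cdot> g) \<cdot> bang V X)"
    if g: "g \<in> hom V (one V) (VHom C T c)" for g
  proof -
    show "cmp g \<in> hom V X (VHom C a c)"
      using g \<gamma> X a c T' by (simp add: cmp_def hom_def)
    have "yoneda a \<cdot> cmp g = act a T \<gamma> (act T c (g \<cdot> bang V X) (x \<cdot> bang V X))"
      using g \<gamma> X a c T' by (simp add: cmp_def hom_def yoneda_Comp act_VComp)
    also have "act T c (g \<cdot> bang V X) (x \<cdot> bang V X) = yoneda T \<cdot> (g \<cdot> bang V X)"
      using g X c T' by (simp add: yoneda_Comp hom_def)
    also have "\<dots> = (yoneda T \<cdot> g) \<cdot> bang V X"
      using g X yoneda_in[OF T'] by (simp add: hom_def)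
    finally show "yoneda a \<cdot> cmp g = act a T \<gamma> ((yoneda T \<cdot> g) \<cdot> bang V X)" .
  qed
  have yoneda_hom: "yoneda b \<cdot> k \<in> hom V Z (FObj F b)" if "b \<in> VObj C" "k \<in> hom V Z (VHom C b c)" for b k Z
    using Comp_in[OF that(2) yoneda_in[OF that(1)]] .
  show ?thesis
  proof (rule bij_betwI')
    fix k k' assume k: "k \<in> hom V X (VHom C a c)" and k': "k' \<in> hom V X (VHom C a c)"
    have "k = k'" if eq: "yoneda a \<cdot> k = yoneda a \<cdot> k'"
    proof -
      obtain g g' where g: "g \<in> hom V (one V) (VHom C T c)" "cmp g = k"
        and g': "g' \<in> hom V (one V) (VHom C T c)" "cmp g' = k'"
        using tensor_hom[OF X a c T k] tensor_hom[OF X a c T k'] unfolding cmp_def by blast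
      have "yoneda T \<cdot> g = yoneda T \<cdot> g'"
        using tensor_elements[OF X a T preserves yoneda_hom[OF a k]]
          yoneda_cmp[OF g(1)] yoneda_cmp[OF g'(1)] yoneda_hom[OF T' g(1)] yoneda_hom[OF T' g'(1)] g(2) g'(2) eq
        by metis
      then have "g = g'"
        using bij[OF T'] g(1) g'(1) unfolding bij_betw_def inj_on_def by blast
      then show "k = k'" using g(2) g'(2) by simp
    qed
    then show "(yoneda a \<cdot> k = yoneda a \<cdot> k') = (k = k')" by blast
  next
    fix k assume "k \<in> hom V X (VHom C a c)"
    then show "yoneda a \<cdot> k \<in> hom V X (FObj F a)" by (rule yoneda_hom[OF a])
  next
    fix h assume h: "h \<in> hom V X (FObj F a)"
    obtain w where w: "w \<in> hom V (one V) (FObj F T)" "act a T \<gamma> (w \<cdot> bang V X) = h"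
      using tensor_elements[OF X a T preserves h] by blast
    obtain g where g: "g \<in> hom V (one V) (VHom C T c)" "yoneda T \<cdot> g = w"
      using bij[OF T'] w(1) unfolding bij_betw_def by (metis imageE)
    have "h = yoneda a \<cdot> cmp g" using yoneda_cmp[OF g(1)] g(2) w(2) by simp
    then show "\<exists>k \<in> hom V X (VHom C a c). h = yoneda a \<cdot> k" using cmp[OF g(1)] by blast
  qed
qed

end



section \<open>Representability and terminal elements\<close>

theorem theorem5:
  fixes V :: "('o, 'm) cat"
    and U :: "'u set"
    and G :: "'o set"
    and C :: "('c, 'o, 'm) vcat"
    and F :: "('c, 'o, 'm) vfun"
    and c :: 'c and x :: 'm
  assumes "infinite U"
    and "extensive U V"
    and "cartesian_closed V"
    and "has_pullbacks V"
    and "conservative V G"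
    and "vcategory V C"
    and "VObj C \<lesssim> U"
    and "\<forall>X \<in> G. has_tensors V C X"
    and "vfunctor V (vop V C) (vself V) F"
    and "\<forall>X \<in> G. preserves_tensors V C F X"
    and "c \<in> VObj C"
    and "x \<in> hom V (one V) (FObj F c)"
  shows "representable_by V C F c x \<longleftrightarrow>
    vterminal V (und V (elements V C F)) (element V C F c x)"
proof -
  interpret category V
    using assms(3)[unfolded cartesian_closed_def] by (rule conjunct1)
  interpret category_of_elements V C F c x U
    by unfold_locales (rule assms)+
  show ?thesis
  proof
    assume "representable_by V C F c x"
    then show "vterminal V (und V (elements V C F)) (element V C F c x)"
      unfolding representable_iff by (rule vterminal_if_yoneda_iso)
  next
    assume terminal: "vterminal V (und V (elements V C F)) (element V C F c x)"
    have "iso V (yoneda a)" if a: "a \<in> VObj C" for a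
    proof -
      have "bij_betw (\<lambda>h. yoneda a \<cdot>\<^bsub>V\<^esub> h) (hom V X (VHom C a c)) (hom V X (FObj F a))"
        if X: "X \<in> G" for X
      proof (rule yoneda_bij_on_tensor_elements)
        show "X \<in> Obj V"
          using assms(5) X unfolding conservative_def by (elim conjE) (rule subsetD)
        show "has_tensors V C X" using assms(8) X by (rule bspec)
        show "preserves_tensors V C F X" using assms(10) X by (rule bspec)
        show "a \<in> VObj C" by (rule a)
      qed (rule yoneda_bij_on_elements[OF terminal])
      then show ?thesis
        unfolding assms(5)[unfolded conservative_def, THEN conjunct2, rule_format, OF yoneda_in[OF a]]
        by (intro ballI)
    qed
    then show "representable_by V C F c x"
      unfolding representable_iff by (intro ballI)
  qed
qed

end
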